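(* Let $\kappa$ be an infinite cardinal with $\kappa = \kappa^{<\kappa}$ and let $x$ be a point of $S_\kappa$. Then every finite compactification of $S_\kappa \setminus \{x\}$ is homeomorphic to $S_\kappa$. Moreover, for every finite compactification $Z$ of $S_\kappa \setminus \{x\}$, at most one point of the remainder $Z \setminus (S_\kappa \setminus \{x\})$ is not a $P_\kappa$-point of $Z$.
   Context: A space is zero-dimensional if it has a basis of clopen sets. In a zero-dimensional space $X$, the type of an open subset $U$ is the least cardinal $\tau$ such that $U$ is a union of $\tau$-many clopen subsets of $X$. An $F_\kappa$-space is a zero-dimensional space in which every open subset of type less than $\kappa$ is $C^*$-embedded (every bounded continuous real-valued function on it extends continuously to the whole space). A $\kappa$-Parovičenko space is a zero-dimensional compact Hausdorff $F_\kappa$-space of weight $\kappa^{<\kappa}$ without isolated points such that every non-empty intersection of fewer than $\kappa$-many open sets has non-empty interior. If $\kappa = \kappa^{<\kappa}$, there is, up to homeomorphism, a unique $\kappa$-Parovičenko space of weight $\kappa$; it is denoted $S_\kappa$ (equivalently, the Stone space of the unique $\kappa$-saturated Boolean algebra of size $\kappa$). A finite compactification of a space $Y$ is a compact Hausdorff space $Z$ containing $Y$ as a dense subspace such that the remainder $Z\setminus Y$ is finite. A point $p$ of a space $Z$ is a $P_\kappa$-point if every intersection of fewer than $\kappa$-many neighbourhoods of $p$ contains an open neighbourhood of $p$. *)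

theory Defs
  imports "HOL-Analysis.Analysis"
begin

unbundle cardinal_syntax

text \<open>
  Cardinals are represented as in \<^theory>\<open>HOL.BNF_Cardinal_Order_Relation\<close>: a cardinal is a relation
  satisfying \<^const>\<open>Card_order\<close>, and \<open>=o\<close>, \<open>\<le>o\<close>, \<open><o\<close> compare cardinals on possibly
  different types.
\<close>

text \<open>
  \<open>\<kappa>\<close> to the power \<open><\<kappa>\<close>, i.e. the cardinality of the set of all functions from a proper initial
  segment of \<open>\<kappa>\<close> to \<open>\<kappa>\<close>. Each function is tagged with the endpoint \<open>a\<close> of its domain, because
  elements of \<^const>\<open>Func\<close> with different domains may coincide as total functions.
\<close>
definition power_less :: "'k rel \<Rightarrow> ('k \<times> ('k \<Rightarrow> 'k)) rel"
  where "power_less \<kappa> = |SIGMA a : Field \<kappa>. Func (underS \<kappa> a) (Field \<kappa>)|"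

text \<open>The least cardinality of a member of the (non-empty) collection \<open>\<F>\<close>.\<close>
definition least_card :: "'a set set \<Rightarrow> 'a rel"
  where "least_card \<F> = |SOME A. A \<in> \<F> \<and> (\<forall>B\<in>\<F>. |A| \<le>o |B| )|"

lemma least_card:
  assumes "\<F> \<noteq> {}"
  shows least_card_attained: "\<exists>A\<in>\<F>. least_card \<F> = |A|"
    and least_card_le: "\<And>B. B \<in> \<F> \<Longrightarrow> least_card \<F> \<le>o |B|"
proof -
  have "card_of ` \<F> \<noteq> {}" "\<forall>r\<in>card_of ` \<F>. Card_order r"
    using assms by (auto simp: card_of_Card_order)
  then have "\<exists>A. A \<in> \<F> \<and> (\<forall>B\<in>\<F>. |A| \<le>o |B| )"
    using exists_minim_Card_order[of "card_of ` \<F>"] by blast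
  from someI_ex[OF this]
  show "\<exists>A\<in>\<F>. least_card \<F> = |A|" "\<And>B. B \<in> \<F> \<Longrightarrow> least_card \<F> \<le>o |B|"
    unfolding least_card_def by blast+
qed

definition is_base :: "'a topology \<Rightarrow> 'a set set \<Rightarrow> bool"
  where "is_base X \<B> \<longleftrightarrow>
    (\<forall>B\<in>\<B>. openin X B) \<and> (\<forall>U. openin X U \<longrightarrow> (\<exists>\<C>\<subseteq>\<B>. \<Union>\<C> = U))"

definition weight :: "'a topology \<Rightarrow> 'a set rel"
  where "weight X = least_card {\<B>. is_base X \<B>}"

definition clopenin :: "'a topology \<Rightarrow> 'a set \<Rightarrow> bool"
  where "clopenin X U \<longleftrightarrow> closedin X U \<and> openin X U"

definition zero_dimensional :: "'a topology \<Rightarrow> bool"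
  where "zero_dimensional X \<longleftrightarrow> (\<exists>\<B>. is_base X \<B> \<and> (\<forall>B\<in>\<B>. clopenin X B))"

text \<open>The type of \<open>U\<close>; only meaningful for \<open>U\<close> open in a zero-dimensional \<open>X\<close>.\<close>
definition open_type :: "'a topology \<Rightarrow> 'a set \<Rightarrow> 'a set rel"
  where "open_type X U = least_card {\<C>. (\<forall>C\<in>\<C>. clopenin X C) \<and> \<Union>\<C> = U}"

definition Cstar_embedded :: "'a topology \<Rightarrow> 'a set \<Rightarrow> bool"
  where "Cstar_embedded X U \<longleftrightarrow>
    (\<forall>f :: 'a \<Rightarrow> real. continuous_map (subtopology X U) euclideanreal f \<and> bounded (f ` U) \<longrightarrow>
      (\<exists>g. continuous_map X euclideanreal g \<and> (\<forall>u\<in>U. g u = f u)))"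

definition F_space :: "'k rel \<Rightarrow> 'a topology \<Rightarrow> bool"
  where "F_space \<kappa> X \<longleftrightarrow> zero_dimensional X \<and>
    (\<forall>U. openin X U \<and> open_type X U <o \<kappa> \<longrightarrow> Cstar_embedded X U)"

text \<open>
  In the last conjunct, intersecting with \<^term>\<open>topspace X\<close> makes the intersection of the empty
  family the whole space.
\<close>
definition Parovicenko_space :: "'k rel \<Rightarrow> 'a topology \<Rightarrow> bool"
  where "Parovicenko_space \<kappa> X \<longleftrightarrow>
    zero_dimensional X \<and> compact_space X \<and> Hausdorff_space X \<and> F_space \<kappa> X \<and>
    weight X =o power_less \<kappa> \<and>
    (\<forall>x\<in>topspace X. \<not> openin X {x}) \<and>
    (\<forall>\<U>. (\<forall>U\<in>\<U>. openin X U) \<and> |\<U>| <o \<kappa> \<and> topspace X \<inter> \<Inter>\<U> \<noteq> {} \<longrightarrow>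
      X interior_of (topspace X \<inter> \<Inter>\<U>) \<noteq> {})"

text \<open>
  \<open>X\<close> is a copy of the space \<open>S\<^sub>\<kappa>\<close>, which is determined only up to homeomorphism. Intended for
  infinite \<open>\<kappa>\<close> with \<open>\<kappa> =o power_less \<kappa>\<close>.
\<close>
definition is_S :: "'k rel \<Rightarrow> 'a topology \<Rightarrow> bool"
  where "is_S \<kappa> X \<longleftrightarrow> Parovicenko_space \<kappa> X \<and> weight X =o \<kappa>"

text \<open>
  A compactification of \<open>Y\<close> is given with its embedding \<open>e\<close> of \<open>Y\<close>, so that \<open>Z\<close> may live on a
  different type; the copy of \<open>Y\<close> inside \<open>Z\<close> is the image of \<open>e\<close>.
\<close>
definition remainder :: "'a topology \<Rightarrow> 'b topology \<Rightarrow> ('a \<Rightarrow> 'b) \<Rightarrow> 'b set"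
  where "remainder Y Z e = topspace Z - e ` topspace Y"

definition finite_compactification :: "'a topology \<Rightarrow> 'b topology \<Rightarrow> ('a \<Rightarrow> 'b) \<Rightarrow> bool"
  where "finite_compactification Y Z e \<longleftrightarrow>
    compact_space Z \<and> Hausdorff_space Z \<and> embedding_map Y Z e \<and>
    Z closure_of (e ` topspace Y) = topspace Z \<and> finite (remainder Y Z e)"

definition neighbourhood_in :: "'a topology \<Rightarrow> 'a \<Rightarrow> 'a set \<Rightarrow> bool"
  where "neighbourhood_in Z p N \<longleftrightarrow> N \<subseteq> topspace Z \<and> (\<exists>U. openin Z U \<and> p \<in> U \<and> U \<subseteq> N)"

definition P_point :: "'k rel \<Rightarrow> 'a topology \<Rightarrow> 'a \<Rightarrow> bool"
  where "P_point \<kappa> Z p \<longleftrightarrow> p \<in> topspace Z \<and>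
    (\<forall>\<N>. (\<forall>N\<in>\<N>. neighbourhood_in Z p N) \<and> |\<N>| <o \<kappa> \<longrightarrow>
      (\<exists>U. openin Z U \<and> p \<in> U \<and> U \<subseteq> \<Inter>\<N>))"

end

theory Submission
  imports Defs "HOL-Algebra.Free_Abelian_Groups"
begin

text \<open>
  Call a compact zero-dimensional space without isolated points saturated if it has at most \<open>\<kappa>\<close> clopen
  sets, non-empty intersections of fewer than \<open>\<kappa>\<close> clopen sets have non-empty interior, and disjoint
  unions of fewer than \<open>\<kappa>\<close> clopen sets can be separated by a clopen set. The space \<open>S\<^sub>\<kappa>\<close> is saturated,
  and a back-and-forth argument of length \<open>\<kappa>\<close> between the algebras of clopen sets shows that any two
  saturated spaces are homeomorphic, so it suffices that every finite compactification \<open>Z\<close> of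
  \<open>S\<^sub>\<kappa> - {x}\<close> is saturated. This rests on one observation: if two unions of fewer than \<open>\<kappa>\<close> compact
  clopen subsets of \<open>S\<^sub>\<kappa> - {x}\<close> are disjoint, then they are separated in \<open>S\<^sub>\<kappa>\<close> by a clopen set, and
  since \<open>x\<close> lies on one side only, one of the two unions does not accumulate at the remainder of \<open>Z\<close>.
  For the same reason two remainder points cannot both fail to be \<open>P\<^sub>\<kappa>\<close>-points.
\<close>

section \<open>Cardinals and clopen sets\<close>

lemma finite_ordLess_Cinfinite:
  assumes "Cinfinite \<kappa>" "finite A"
  shows "|A| <o \<kappa>"
  using assms by (auto simp: cinfinite_def Field_card_of card_of_Card_order
      intro!: finite_ordLess_infinite card_order_on_well_order_on[OF card_of_card_order_on]
        card_order_on_well_order_on)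

lemma card_of_image_ordLess:
  "|A| <o \<kappa> \<Longrightarrow> |f ` A| <o \<kappa>"
  using card_of_image ordLeq_ordLess_trans by blast

lemma card_of_Fpow_ordLess:
  assumes "Cinfinite \<kappa>" "|A| <o \<kappa>"
  shows "|Fpow A| <o \<kappa>"
proof (cases "finite A")
  case True
  then have "finite (Fpow A)"
    by (auto simp: Fpow_def intro: finite_subset[of _ "Pow A"])
  then show ?thesis
    using assms finite_ordLess_Cinfinite by blast
next
  case False
  then show ?thesis
    using assms card_of_Fpow_infinite ordIso_ordLess_trans by blast
qed

lemma card_of_Fpow_ordLeq:
  assumes "Cinfinite \<kappa>" "|A| \<le>o \<kappa>"
  shows "|Fpow A| \<le>o \<kappa>"
proof (cases "finite A")
  case True
  then have "finite (Fpow A)"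
    by (auto simp: Fpow_def intro: finite_subset[of _ "Pow A"])
  then show ?thesis
    using assms finite_ordLess_Cinfinite ordLess_imp_ordLeq by blast
next
  case False
  then show ?thesis
    using assms card_of_Fpow_infinite ordIso_ordLeq_trans by blast
qed

lemma clopenin_subset: "clopenin X c \<Longrightarrow> c \<subseteq> topspace X"
  by (simp add: clopenin_def openin_subset)

lemma clopenin_empty [simp]: "clopenin X {}"
  by (simp add: clopenin_def)

lemma clopenin_topspace [simp]: "clopenin X (topspace X)"
  by (simp add: clopenin_def)

lemma clopenin_Int: "clopenin X a \<Longrightarrow> clopenin X b \<Longrightarrow> clopenin X (a \<inter> b)"
  by (auto simp: clopenin_def)

lemma clopenin_Un: "clopenin X a \<Longrightarrow> clopenin X b \<Longrightarrow> clopenin X (a \<union> b)"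
  by (auto simp: clopenin_def)

lemma clopenin_diff: "clopenin X a \<Longrightarrow> clopenin X b \<Longrightarrow> clopenin X (a - b)"
  by (auto simp: clopenin_def)

lemma clopenin_compl: "clopenin X a \<Longrightarrow> clopenin X (topspace X - a)"
  by (simp add: clopenin_diff)

lemma clopenin_Union: "finite \<C> \<Longrightarrow> (\<And>c. c \<in> \<C> \<Longrightarrow> clopenin X c) \<Longrightarrow> clopenin X (\<Union>\<C>)"
  by (induction \<C> rule: finite_induct) (auto simp: clopenin_Un)

lemma clopenin_Inter:
  "finite \<C> \<Longrightarrow> (\<And>c. c \<in> \<C> \<Longrightarrow> clopenin X c) \<Longrightarrow> clopenin X (topspace X \<inter> \<Inter>\<C>)"
  by (induction \<C> rule: finite_induct) (auto simp: Int_left_commute[of "topspace X"] clopenin_Int)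

section \<open>Compactness and clopen bases\<close>

lemma compact_space_finite_Inter_empty:
  assumes "compact_space X" "closedin X K" "\<And>C. C \<in> \<C> \<Longrightarrow> closedin X C" "K \<inter> \<Inter>\<C> = {}"
  obtains \<F> where "finite \<F>" "\<F> \<subseteq> \<C>" "K \<inter> \<Inter>\<F> = {}"
  using closedin_compact_space[OF assms(1,2)] assms(3,4) unfolding compactin_fip by meson

text \<open>The pointwise form of zero-dimensionality; it avoids carrying a chosen base through the
  proofs.\<close>

definition clopen_based :: "'a topology \<Rightarrow> bool"
  where "clopen_based X \<longleftrightarrow> (\<forall>U x. openin X U \<and> x \<in> U \<longrightarrow> (\<exists>c. clopenin X c \<and> x \<in> c \<and> c \<subseteq> U))"

lemma clopen_basedE:
  assumes "clopen_based X" "openin X U" "x \<in> U"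
  obtains c where "clopenin X c" "x \<in> c" "c \<subseteq> U"
  using assms unfolding clopen_based_def by blast

lemma zero_dimensional_imp_clopen_based:
  assumes "zero_dimensional X"
  shows "clopen_based X"
  unfolding clopen_based_def
proof (intro allI impI, elim conjE)
  fix U x assume "openin X U" "x \<in> U"
  then obtain \<B> \<C> where "\<forall>B\<in>\<B>. clopenin X B" "\<C> \<subseteq> \<B>" "\<Union>\<C> = U"
    using assms unfolding zero_dimensional_def is_base_def by meson
  then show "\<exists>c. clopenin X c \<and> x \<in> c \<and> c \<subseteq> U"
    using \<open>x \<in> U\<close> by blast
qed

lemma Hausdorff_openin_topspace_delete:
  "Hausdorff_space X \<Longrightarrow> openin X (topspace X - {q})"
  by (metis Hausdorff_imp_t1_space openin_topspace t1_space_openin_delete_alt)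

text \<open>Finitely many small clopen sets cover \<open>K\<close>. Clopen neighbourhoods are
  demanded only at points of \<open>K\<close>, so that the lemma can serve in a compactification
  before clopen sets are known around the remainder points.\<close>

lemma clopen_between_compactin_open:
  assumes "compactin X K" "openin X U" "K \<subseteq> U"
    and local: "\<And>x. x \<in> K \<Longrightarrow> \<exists>c. clopenin X c \<and> x \<in> c \<and> c \<subseteq> U"
  obtains c where "clopenin X c" "K \<subseteq> c" "c \<subseteq> U"
proof -
  obtain \<F> where \<F>: "finite \<F>" "\<F> \<subseteq> {c. clopenin X c \<and> c \<subseteq> U}" "K \<subseteq> \<Union>\<F>"
    using assms(1) local unfolding compactin_def clopenin_def
    by (smt (verit, del_insts) UnionI mem_Collect_eq subset_iff)
  show ?thesis
  proof
    show "clopenin X (\<Union>\<F>)" using \<F> by (intro clopenin_Union) auto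
  qed (use \<F> in auto)
qed

lemma clopen_between_closed_open:
  assumes "compact_space X" "clopen_based X" "closedin X K" "openin X U" "K \<subseteq> U"
  obtains c where "clopenin X c" "K \<subseteq> c" "c \<subseteq> U"
  using clopen_between_compactin_open[OF closedin_compact_space[OF assms(1,3)] assms(4,5)]
    clopen_basedE[OF assms(2,4)] assms(5) by (metis subsetD)

lemma clopen_separation_of_disjoint_closures:
  assumes "compact_space X" "clopen_based X" "A \<subseteq> topspace X"
    "X closure_of A \<inter> X closure_of B = {}" "B \<subseteq> topspace X"
  obtains c where "clopenin X c" "A \<subseteq> c" "c \<inter> B = {}"
proof -
  obtain c where c: "clopenin X c" "X closure_of A \<subseteq> c" "c \<subseteq> topspace X - X closure_of B"
    by (rule clopen_between_closed_open[OF assms(1,2), of "X closure_of A" "topspace X - X closure_of B"])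
      (use assms(4) in \<open>auto simp: closure_of_subset_topspace[THEN subsetD]\<close>)
  then show ?thesis
    using that[of c] closure_of_subset[OF assms(3)] closure_of_subset[OF assms(5)] by blast
qed

text \<open>A clopen subset of a compact space is compact and open, hence a finite union of members
  of the base; a base of size at most \<kappa> has at most \<kappa> finite subsets.\<close>

lemma compact_clopens_card:
  assumes "compact_space X" "Cinfinite \<kappa>" "is_base X \<B>" "|\<B>| \<le>o \<kappa>"
  shows "|{c. clopenin X c}| \<le>o \<kappa>"
proof -
  have "{c. clopenin X c} \<subseteq> Union ` Fpow \<B>"
  proof
    fix c assume "c \<in> {c. clopenin X c}"
    then have c: "compactin X c" "openin X c"
      using assms(1) by (auto simp: clopenin_def closedin_compact_space)
    then obtain \<C> where \<C>: "\<C> \<subseteq> \<B>" "\<Union>\<C> = c"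
      using assms(3) unfolding is_base_def by meson
    then obtain \<F> where "finite \<F>" "\<F> \<subseteq> \<C>" "c \<subseteq> \<Union>\<F>"
      using c(1) assms(3) unfolding compactin_def is_base_def
      by (metis order_refl subsetD)
    then have "\<F> \<in> Fpow \<B>" "\<Union>\<F> = c"
      using \<C> by (auto simp: Fpow_def)
    then show "c \<in> Union ` Fpow \<B>" by blast
  qed
  then have "|{c. clopenin X c}| \<le>o |Union ` Fpow \<B>|"
    by (rule card_of_mono1)
  also have "|Union ` Fpow \<B>| \<le>o |Fpow \<B>|"
    by (rule card_of_image)
  also have "|Fpow \<B>| \<le>o \<kappa>"
    by (rule card_of_Fpow_ordLeq[OF assms(2,4)])
  finally show ?thesis .
qed

section \<open>Saturated Stone spaces\<close>

text \<open>\<open>clopen_in_Inter\<close> and \<open>separation\<close> express saturation of the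
  Boolean algebra of clopen sets. The point \<open>x\<close> in \<open>clopen_in_Inter\<close>
  witnesses that the intersection is non-empty, also for the empty family. The bound on the number
  of clopen sets allows an enumeration along \<kappa>.\<close>

locale saturated_Stone_space =
  fixes \<kappa> :: "'k rel" and X :: "'a topology"
  assumes Cinfinite: "Cinfinite \<kappa>"
    and compact: "compact_space X"
    and Hausdorff: "Hausdorff_space X"
    and clopen_based: "clopen_based X"
    and nonempty: "topspace X \<noteq> {}"
    and not_isolated: "\<And>x. \<not> openin X {x}"
    and clopens_card: "|{c. clopenin X c}| \<le>o \<kappa>"
    and clopen_in_Inter: "\<And>\<U> x. \<lbrakk>\<And>U. U \<in> \<U> \<Longrightarrow> clopenin X U \<and> x \<in> U; x \<in> topspace X; |\<U>| <o \<kappa>\<rbrakk>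
      \<Longrightarrow> \<exists>c. clopenin X c \<and> c \<noteq> {} \<and> (\<forall>U\<in>\<U>. c \<subseteq> U)"
    and separation: "\<And>\<S> \<T>. \<lbrakk>\<And>S. S \<in> \<S> \<Longrightarrow> clopenin X S; \<And>T. T \<in> \<T> \<Longrightarrow> clopenin X T;
        |\<S>| <o \<kappa>; |\<T>| <o \<kappa>; \<Union>\<S> \<inter> \<Union>\<T> = {}\<rbrakk>
      \<Longrightarrow> \<exists>c. clopenin X c \<and> \<Union>\<S> \<subseteq> c \<and> c \<inter> \<Union>\<T> = {}"
begin

text \<open>Each point of \<open>Q\<close> is excluded by some clopen neighbourhood of
  \<open>w\<close>. These are fewer than \<kappa>, so their intersection with a neighbourhood inside
  \<open>U\<close> contains a non-empty clopen set.\<close>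

lemma ex_clopen_avoiding_points_near:
  assumes "openin X U" "w \<in> U" "|Q| <o \<kappa>" "w \<notin> Q"
  shows "\<exists>c. clopenin X c \<and> c \<noteq> {} \<and> c \<subseteq> U - Q"
proof -
  have w: "w \<in> topspace X"
    using assms openin_subset by blast
  obtain V where V: "clopenin X V" "w \<in> V" "V \<subseteq> U"
    using clopen_basedE[OF clopen_based assms(1,2)] .
  have "\<exists>n. clopenin X n \<and> w \<in> n \<and> q \<notin> n" if "q \<in> Q" for q
  proof -
    have "openin X (topspace X - {q})"
      by (rule Hausdorff_openin_topspace_delete[OF Hausdorff])
    then show ?thesis
      using clopen_basedE[OF clopen_based, of "topspace X - {q}" w] w assms(4) that by blast
  qed
  then obtain n where n: "\<And>q. q \<in> Q \<Longrightarrow> clopenin X (n q) \<and> w \<in> n q \<and> q \<notin> n q"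
    by metis
  have "|{V} \<union> n ` Q| <o \<kappa>"
    by (intro Un_Cinfinite_bound_strict card_of_image_ordLess assms Cinfinite)
      (use finite_ordLess_Cinfinite[OF Cinfinite, of "{V}"] in simp)
  then have "\<exists>c. clopenin X c \<and> c \<noteq> {} \<and> (\<forall>U\<in>{V} \<union> n ` Q. c \<subseteq> U)"
    using V n w by (intro clopen_in_Inter[of _ w]) auto
  then obtain c where c: "clopenin X c" "c \<noteq> {}" "c \<subseteq> V" "\<And>q. q \<in> Q \<Longrightarrow> c \<subseteq> n q"
    by auto
  then show ?thesis
    using n V by blast
qed

text \<open>If fewer than \<open>\<kappa>\<close> points filled an open set, each of them would be an intersection of fewer
  than \<open>\<kappa>\<close> clopen sets, hence isolated.\<close>

lemma ex_clopen_avoiding_points: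
  assumes "openin X U" "U \<noteq> {}" "|Q| <o \<kappa>"
  shows "\<exists>c. clopenin X c \<and> c \<noteq> {} \<and> c \<subseteq> U - Q"
proof -
  obtain w where w: "w \<in> U" using assms by blast
  have "|Q - {w}| <o \<kappa>"
    using card_of_mono1[of "Q - {w}" Q] assms(3) ordLeq_ordLess_trans by blast
  then obtain c where c: "clopenin X c" "c \<noteq> {}" "c \<subseteq> U - (Q - {w})"
    using ex_clopen_avoiding_points_near[OF assms(1) w, of "Q - {w}"] by auto
  have "c \<noteq> {w}"
    using c(1) not_isolated by (auto simp: clopenin_def)
  then obtain w' where "w' \<in> c" "w' \<noteq> w" using c(2) by blast
  then show ?thesis
    using ex_clopen_avoiding_points_near[OF assms(1), of w' Q] c(3) assms(3) by auto
qed

text \<open>No recursion along \<open>I\<close> is required: fix points \<open>y i\<close> in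
  \<open>W i\<close> and let every \<open>c i\<close> avoid all of these points at once. Each
  \<open>y i\<close> then lies outside every \<open>c j\<close>, and the intersection of these fewer
  than \<kappa> complements leaves room for \<open>d i\<close> inside \<open>W i\<close>.\<close>

lemma bisect_open_family:
  fixes W :: "'i \<Rightarrow> 'a set"
  assumes "|I| <o \<kappa>" "\<And>i. i \<in> I \<Longrightarrow> openin X (W i) \<and> W i \<noteq> {}"
  shows "\<exists>c d. (\<forall>i\<in>I. clopenin X (c i) \<and> c i \<noteq> {} \<and> c i \<subseteq> W i) \<and>
    (\<forall>i\<in>I. clopenin X (d i) \<and> d i \<noteq> {} \<and> d i \<subseteq> W i) \<and> (\<forall>i\<in>I. \<forall>j\<in>I. c i \<inter> d j = {})"
proof -
  have "\<forall>i\<in>I. \<exists>y. y \<in> W i"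
    using assms(2) by blast
  then obtain y where y: "\<And>i. i \<in> I \<Longrightarrow> y i \<in> W i"
    by metis
  have "\<exists>c. clopenin X c \<and> c \<noteq> {} \<and> c \<subseteq> W i - y ` I" if "i \<in> I" for i
    using ex_clopen_avoiding_points[of "W i" "y ` I"] assms that card_of_image_ordLess by blast
  then obtain c where c: "\<And>i. i \<in> I \<Longrightarrow> clopenin X (c i) \<and> c i \<noteq> {} \<and> c i \<subseteq> W i - y ` I"
    by metis
  have "\<exists>d. clopenin X d \<and> d \<noteq> {} \<and> d \<subseteq> W i \<and> (\<forall>j\<in>I. c j \<inter> d = {})" if i: "i \<in> I" for i
  proof -
    obtain V where V: "clopenin X V" "y i \<in> V" "V \<subseteq> W i"
      using clopen_basedE[OF clopen_based, of "W i" "y i"] assms(2) y i by auto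
    have "|{V} \<union> (\<lambda>j. topspace X - c j) ` I| <o \<kappa>"
      by (intro Un_Cinfinite_bound_strict card_of_image_ordLess assms Cinfinite)
        (use finite_ordLess_Cinfinite[OF Cinfinite, of "{V}"] in simp)
    moreover have "y i \<in> topspace X"
      using V clopenin_subset by blast
    ultimately have "\<exists>d. clopenin X d \<and> d \<noteq> {} \<and> (\<forall>U\<in>{V} \<union> (\<lambda>j. topspace X - c j) ` I. d \<subseteq> U)"
      using V c i by (intro clopen_in_Inter[of _ "y i"]) (auto intro!: clopenin_compl)
    then obtain d where d: "clopenin X d" "d \<noteq> {}" "d \<subseteq> V" "\<And>j. j \<in> I \<Longrightarrow> d \<subseteq> topspace X - c j"
      by auto
    then have "\<forall>j\<in>I. c j \<inter> d = {}"
      by blast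
    then show ?thesis
      using V d by blast
  qed
  then obtain d where "\<And>i. i \<in> I \<Longrightarrow> clopenin X (d i) \<and> d i \<noteq> {} \<and> d i \<subseteq> W i \<and> (\<forall>j\<in>I. c j \<inter> d i = {})"
    by metis
  with c show ?thesis
    by (intro exI[of _ c] exI[of _ d]) auto
qed

end

section \<open>Saturation of the Parovicenko space\<close>

text \<open>The condition on intersections of open sets gives \<open>clopen_in_Inter\<close>, and
  C*-embedding gives \<open>separation\<close>: a function that tells the two unions apart extends
  to the whole space, where a clopen set fits between two of its level sets.\<close>

lemma Parovicenko_imp_saturated:
  fixes \<kappa> :: "'k rel" and X :: "'a topology"
  assumes \<kappa>: "Cinfinite \<kappa>" and X: "Parovicenko_space \<kappa> X" "weight X =o \<kappa>" and ne: "topspace X \<noteq> {}"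
  shows "saturated_Stone_space \<kappa> X"
proof
  show "Cinfinite \<kappa>" "topspace X \<noteq> {}" by fact+
  show cpt: "compact_space X" and "Hausdorff_space X"
    using X by (auto simp: Parovicenko_space_def)
  show cb: "clopen_based X"
    using X by (auto simp: Parovicenko_space_def zero_dimensional_imp_clopen_based)
  show "\<not> openin X {x}" for x
    using X openin_subset[of X "{x}"] unfolding Parovicenko_space_def by auto
  have "{\<B>. is_base X \<B>} \<noteq> {}"
    using X by (auto simp: Parovicenko_space_def zero_dimensional_def)
  from least_card_attained[OF this] obtain \<B> where \<B>: "is_base X \<B>" "weight X = |\<B>|"
    by (auto simp: weight_def)
  then have "|\<B>| \<le>o \<kappa>"
    using X(2) ordIso_iff_ordLeq by metis
  then show "|{c. clopenin X c}| \<le>o \<kappa>"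
    using compact_clopens_card[OF cpt \<kappa>] \<B> by blast
  show "\<exists>c. clopenin X c \<and> c \<noteq> {} \<and> (\<forall>U\<in>\<U>. c \<subseteq> U)"
    if "\<And>U. U \<in> \<U> \<Longrightarrow> clopenin X U \<and> x \<in> U" "x \<in> topspace X" "|\<U>| <o \<kappa>" for \<U> x
  proof -
    have "X interior_of (topspace X \<inter> \<Inter>\<U>) \<noteq> {}"
      using X(1) that unfolding Parovicenko_space_def clopenin_def by blast
    then obtain w where "w \<in> X interior_of (topspace X \<inter> \<Inter>\<U>)" by blast
    then obtain c where "clopenin X c" "w \<in> c" "c \<subseteq> X interior_of (topspace X \<inter> \<Inter>\<U>)"
      using clopen_basedE[OF cb openin_interior_of] by metis
    then show ?thesis
      using interior_of_subset[of X "topspace X \<inter> \<Inter>\<U>"] by blast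
  qed
  show "\<exists>c. clopenin X c \<and> \<Union>\<S> \<subseteq> c \<and> c \<inter> \<Union>\<T> = {}"
    if \<S>: "\<And>S. S \<in> \<S> \<Longrightarrow> clopenin X S" and \<T>: "\<And>T. T \<in> \<T> \<Longrightarrow> clopenin X T"
      and card: "|\<S>| <o \<kappa>" "|\<T>| <o \<kappa>" and disj: "\<Union>\<S> \<inter> \<Union>\<T> = {}" for \<S> \<T>
  proof -
    define U where "U = \<Union>\<S> \<union> \<Union>\<T>"
    \<comment> \<open>On \<open>U\<close> this is 0 on the first union and 1 on the second, and it
      is continuous there because both unions are open and disjoint.\<close>
    define f :: "'a \<Rightarrow> real" where "f = (\<lambda>x. if x \<in> \<Union>\<T> then 1 else 0)"
    have op: "openin X (\<Union>\<S>)" "openin X (\<Union>\<T>)"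
      using \<S> \<T> by (auto simp: clopenin_def)
    then have opU: "openin X U" by (auto simp: U_def)
    have "|\<S> \<union> \<T>| <o \<kappa>"
      by (rule Un_Cinfinite_bound_strict[OF card \<kappa>])
    moreover have mem: "\<S> \<union> \<T> \<in> {\<C>. (\<forall>C\<in>\<C>. clopenin X C) \<and> \<Union>\<C> = U}"
      using \<S> \<T> by (auto simp: U_def)
    then have "open_type X U \<le>o |\<S> \<union> \<T>|"
      unfolding open_type_def using least_card_le[OF _ mem] by blast
    ultimately have "open_type X U <o \<kappa>"
      by (metis ordLeq_ordLess_trans)
    then have emb: "Cstar_embedded X U"
      using X(1) opU by (auto simp: Parovicenko_space_def F_space_def)
    have "continuous_map (subtopology X U) euclideanreal f"
    proof (unfold continuous_map_def, intro conjI allI impI)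
      fix G :: "real set"
      have "topspace (subtopology X U) = U"
        using openin_subset[OF opU] by auto
      then have "{x \<in> topspace (subtopology X U). f x \<in> G} =
          (if 0 \<in> G then \<Union>\<S> else {}) \<union> (if 1 \<in> G then \<Union>\<T> else {})"
        using disj by (auto simp only: f_def U_def split: if_splits)
      also have "openin X \<dots>"
        using op by (intro openin_Un) auto
      finally have "openin X {x \<in> topspace (subtopology X U). f x \<in> G}" .
      then show "openin (subtopology X U) {x \<in> topspace (subtopology X U). f x \<in> G}"
        using opU by (auto simp: openin_open_subtopology)
    qed auto
    moreover have "bounded (f ` U)"
      by (rule bounded_subset[of "{0, 1}"]) (auto simp: f_def)
    ultimately obtain g where g: "continuous_map X euclideanreal g" "\<And>u. u \<in> U \<Longrightarrow> g u = f u"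
      using emb unfolding Cstar_embedded_def by blast
    \<comment> \<open>Any clopen set between these two sets contains the first union, where
      \<open>g\<close> is 0, and misses the second, where \<open>g\<close> is 1.\<close>
    have "closedin X {x \<in> topspace X. g x \<in> {..1/2}}" "openin X {x \<in> topspace X. g x \<in> {..<1}}"
      using closedin_continuous_map_preimage[OF g(1), of "{..1/2}"]
        openin_continuous_map_preimage[OF g(1), of "{..<1}"] by simp_all
    then obtain c where "clopenin X c" and c: "{x \<in> topspace X. g x \<in> {..1/2}} \<subseteq> c"
        "c \<subseteq> {x \<in> topspace X. g x \<in> {..<1}}"
      by (rule clopen_between_closed_open[OF cpt cb]) auto
    moreover have "\<Union>\<S> \<subseteq> c"
    proof
      fix x assume "x \<in> \<Union>\<S>"
      then have "x \<in> topspace X" "g x = 0"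
        using disj openin_subset[OF op(1)] g(2)[of x] by (auto simp: f_def U_def)
      then show "x \<in> c" using c by auto
    qed
    moreover have "c \<inter> \<Union>\<T> = {}"
    proof -
      have "g x = 1" if "x \<in> \<Union>\<T>" for x
        using that g(2)[of x] by (auto simp: f_def U_def)
      then show ?thesis using c(2) by fastforce
    qed
    ultimately show ?thesis by blast
  qed
qed

section \<open>Back and forth\<close>

text \<open>Viewing points as ultrafilters of clopen sets, \<open>x\<close> and \<open>z\<close>
  agree along all pairs of \<open>G\<close>.\<close>

definition matched :: "'a topology \<Rightarrow> 'b topology \<Rightarrow> ('a set \<times> 'b set) set \<Rightarrow> 'a \<Rightarrow> 'b \<Rightarrow> bool"
  where "matched X Z G x z \<longleftrightarrow>
    x \<in> topspace X \<and> z \<in> topspace Z \<and> (\<forall>(a, b)\<in>G. x \<in> a \<longleftrightarrow> z \<in> b)"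

text \<open>By compactness, \<open>G\<close> is a matching iff it extends to an isomorphism between the algebras of
  clopen sets generated by its two projections.\<close>

definition matching :: "'a topology \<Rightarrow> 'b topology \<Rightarrow> ('a set \<times> 'b set) set \<Rightarrow> bool"
  where "matching X Z G \<longleftrightarrow>
    (\<forall>(a, b)\<in>G. clopenin X a \<and> clopenin Z b) \<and>
    (\<forall>x\<in>topspace X. \<exists>z. matched X Z G x z) \<and> (\<forall>z\<in>topspace Z. \<exists>x. matched X Z G x z)"

text \<open>Adding the pairs of complements lets finite intersections express every finite
  conjunction of conditions of the form "in \<open>a\<close>" or "not in \<open>a\<close>".\<close>

definition literals :: "'a topology \<Rightarrow> 'b topology \<Rightarrow> ('a set \<times> 'b set) set \<Rightarrow> ('a set \<times> 'b set) set"
  where "literals X Z G = G \<union> (\<lambda>(a, b). (topspace X - a, topspace Z - b)) ` G"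

lemma matched_converse: "matched Z X (G\<inverse>) z x \<longleftrightarrow> matched X Z G x z"
  by (auto simp: matched_def)

lemma matching_converse: "matching Z X (G\<inverse>) \<longleftrightarrow> matching X Z G"
  unfolding matching_def matched_converse by auto

lemma literals_converse: "literals Z X (G\<inverse>) = (literals X Z G)\<inverse>"
  by (force simp: literals_def)

lemma literals_UN: "literals X Z G = (\<Union>g\<in>G. literals X Z {g})"
  unfolding literals_def by blast

lemma matched_antimono: "matched X Z G x z \<Longrightarrow> F \<subseteq> G \<Longrightarrow> matched X Z F x z"
  unfolding matched_def by blast

lemma matching_antimono: "matching X Z G \<Longrightarrow> F \<subseteq> G \<Longrightarrow> matching X Z F"
  unfolding matching_def by (meson matched_antimono subsetD)

lemma matchedD: "matched X Z G x z \<Longrightarrow> (a, b) \<in> G \<Longrightarrow> x \<in> a \<longleftrightarrow> z \<in> b"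
  by (auto simp: matched_def)

lemma matched_insert:
  "matched X Z (insert (a, b) G) x z \<longleftrightarrow> matched X Z G x z \<and> (x \<in> a \<longleftrightarrow> z \<in> b)"
  by (auto simp: matched_def)

lemma matched_literals:
  "matched X Z G x z \<Longrightarrow> (a, b) \<in> literals X Z G \<Longrightarrow> x \<in> a \<longleftrightarrow> z \<in> b"
  by (auto simp: matched_def literals_def)

lemma matched_Inter_literals:
  "matched X Z G x z \<Longrightarrow> i \<subseteq> literals X Z G \<Longrightarrow> x \<in> \<Inter>(fst ` i) \<longleftrightarrow> z \<in> \<Inter>(snd ` i)"
  using matched_literals[of X Z G x z] by fastforce

lemma clopenin_literals:
  assumes "\<forall>(a, b)\<in>G. clopenin X a \<and> clopenin Z b" "(a, b) \<in> literals X Z G"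
  shows "clopenin X a \<and> clopenin Z b"
  using assms by (auto simp: literals_def intro!: clopenin_compl)

text \<open>A point of \<open>K\<close> that satisfies all literals true at \<open>x\<close> would
  be matched with \<open>x\<close>. Hence the closed sets given by these literals have no common
  point in \<open>K\<close>, and by compactness finitely many of them already have none.\<close>

lemma separating_literals:
  assumes Z: "compact_space Z" and G: "\<forall>(a, b)\<in>G. clopenin X a \<and> clopenin Z b"
    and K: "closedin Z K" and x: "x \<in> topspace X" and none: "\<And>z. z \<in> K \<Longrightarrow> \<not> matched X Z G x z"
  obtains i where "i \<in> Fpow (literals X Z G)" "x \<in> \<Inter>(fst ` i)" "K \<inter> \<Inter>(snd ` i) = {}"
proof -
  let ?L = "{l \<in> literals X Z G. x \<in> fst l}"
  have empty: "K \<inter> \<Inter>(snd ` ?L) = {}"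
  proof (rule ccontr)
    assume "K \<inter> \<Inter>(snd ` ?L) \<noteq> {}"
    then obtain z where z: "z \<in> K" "\<And>a b. (a, b) \<in> literals X Z G \<Longrightarrow> x \<in> a \<Longrightarrow> z \<in> b"
      by force
    have zZ: "z \<in> topspace Z" using z(1) K closedin_subset by blast
    have "x \<in> a \<longleftrightarrow> z \<in> b" if "(a, b) \<in> G" for a b
    proof -
      have "(a, b) \<in> literals X Z G" "(topspace X - a, topspace Z - b) \<in> literals X Z G"
        using that by (auto simp: literals_def)
      then show ?thesis using z(2) x by blast
    qed
    then show False using none[OF z(1)] x zZ by (auto simp: matched_def)
  qed
  have closed: "closedin Z C" if "C \<in> snd ` ?L" for C
    using that clopenin_literals[OF G] by (auto simp: clopenin_def)
  obtain \<F> where \<F>: "finite \<F>" "\<F> \<subseteq> snd ` ?L" "K \<inter> \<Inter>\<F> = {}"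
    by (rule compact_space_finite_Inter_empty[OF Z K closed empty])
  obtain i where "i \<subseteq> ?L" "finite i" "\<F> = snd ` i"
    using finite_subset_image[OF \<F>(1,2)] by metis
  then show ?thesis
    using \<F> by (intro that[of i]) (auto simp: Fpow_def)
qed

text \<open>If a point had no partner, \<open>separating_literals\<close> with the whole space as
  \<open>K\<close> would give a finite contradictory set of literals. It involves only finitely many
  pairs of \<open>G\<close>, and those form a matching.\<close>

lemma matching_finite_character:
  assumes X: "compact_space X" and Z: "compact_space Z"
    and fin: "\<And>F. finite F \<Longrightarrow> F \<subseteq> G \<Longrightarrow> matching X Z F"
  shows "matching X Z G"
proof -
  \<comment> \<open>Stated for arbitrary spaces so that it applies a second time, to the converse
    relation.\<close>
  have half: "\<exists>z. matched X Z G x z"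
    if Z: "compact_space Z" and fin: "\<And>F. finite F \<Longrightarrow> F \<subseteq> G \<Longrightarrow> matching X Z F" and x: "x \<in> topspace X"
    for X :: "'c topology" and Z :: "'d topology" and G x
  proof (rule ccontr)
    assume none: "\<nexists>z. matched X Z G x z"
    then have none': "\<And>z. z \<in> topspace Z \<Longrightarrow> \<not> matched X Z G x z" by blast
    have "clopenin X a \<and> clopenin Z b" if "(a, b) \<in> G" for a b
      using fin[of "{(a, b)}"] that by (auto simp: matching_def)
    then have clo: "\<forall>(a, b)\<in>G. clopenin X a \<and> clopenin Z b" by blast
    obtain i where i: "i \<in> Fpow (literals X Z G)" "x \<in> \<Inter>(fst ` i)" "topspace Z \<inter> \<Inter>(snd ` i) = {}"
      by (rule separating_literals[OF Z clo closedin_topspace x none'])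
    have "\<exists>F. finite F \<and> F \<subseteq> G \<and> l \<in> literals X Z F" if "l \<in> i" for l
    proof -
      have "l \<in> literals X Z G" using that i by (auto simp: Fpow_def)
      then have "\<exists>g\<in>G. l \<in> literals X Z {g}"
        by (simp add: literals_UN[of X Z G])
      then obtain g where "g \<in> G" "l \<in> literals X Z {g}" ..
      then show ?thesis by (intro exI[of _ "{g}"]) auto
    qed
    then obtain F where F: "\<And>l. l \<in> i \<Longrightarrow> finite (F l) \<and> F l \<subseteq> G \<and> l \<in> literals X Z (F l)"
      by metis
    have "i \<subseteq> literals X Z (\<Union>(F ` i))"
      using F by (fastforce simp: literals_def)
    moreover have "matching X Z (\<Union>(F ` i))"
      using F i by (intro fin) (auto simp: Fpow_def)
    then obtain z where z: "matched X Z (\<Union>(F ` i)) x z"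
      using x unfolding matching_def by blast
    ultimately have "z \<in> \<Inter>(snd ` i)"
      using i(2) matched_Inter_literals by metis
    then show False
      using i(3) z by (auto simp: matched_def)
  qed
  have "clopenin X a \<and> clopenin Z b" if "(a, b) \<in> G" for a b
    using fin[of "{(a, b)}"] that by (auto simp: matching_def)
  moreover have "\<exists>z. matched X Z G x z" if "x \<in> topspace X" for x
    by (rule half[OF Z fin that])
  moreover have "\<exists>x. matched X Z G x z" if "z \<in> topspace Z" for z
  proof -
    have fin': "matching Z X F" if "finite F" "F \<subseteq> G\<inverse>" for F
    proof -
      have "matching X Z (F\<inverse>)"
        using that by (intro fin) auto
      then show ?thesis
        using matching_converse[of Z X "F\<inverse>"] by simp
    qed
    have "\<exists>x. matched Z X (G\<inverse>) z x"
      by (rule half[OF X fin' that])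
    then show ?thesis
      unfolding matched_converse .
  qed
  ultimately show ?thesis
    by (auto simp: matching_def)
qed

text \<open>The prospective partner \<open>b\<close> of \<open>a\<close> is forced on the sets \<open>v i\<close> whose counterpart \<open>u i\<close> lies
  inside or outside \<open>a\<close>; every other \<open>v i\<close> has to meet both \<open>b\<close> and its complement, which is
  achieved by bisecting the part of \<open>v i\<close> on which \<open>b\<close> is still undetermined.\<close>

lemma extend_matching:
  fixes \<kappa> :: "'k rel" and X :: "'a topology" and Z :: "'b topology"
  assumes X: "compact_space X" and Z: "saturated_Stone_space \<kappa> Z"
    and G: "matching X Z G" "|G| <o \<kappa>" and a: "clopenin X a"
  obtains b where "matching X Z (insert (a, b) G)"
proof -
  interpret Z: saturated_Stone_space \<kappa> Z by (rule Z)
  define L where "L = literals X Z G"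
  \<comment> \<open>\<open>u i\<close> and \<open>v i\<close> are the two sides of the conjunction
    of the literals in \<open>i\<close>; intersecting with the space makes the empty conjunction the
    whole space.\<close>
  define u where "u i = topspace X \<inter> \<Inter>(fst ` i)" for i :: "('a set \<times> 'b set) set"
  define v where "v i = topspace Z \<inter> \<Inter>(snd ` i)" for i :: "('a set \<times> 'b set) set"
  define \<S> where "\<S> = v ` {i \<in> Fpow L. u i \<subseteq> a}"
  define \<T> where "\<T> = v ` {i \<in> Fpow L. u i \<inter> a = {}}"
  \<comment> \<open>The indices for which part of \<open>v i\<close> is left undecided by the forced
    sets.\<close>
  define J where "J = {i \<in> Fpow L. \<not> v i \<subseteq> \<Union>\<S> \<union> \<Union>\<T>}"
  have clo: "\<forall>(a, b)\<in>G. clopenin X a \<and> clopenin Z b"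
    using G(1) by (auto simp: matching_def)
  have u: "clopenin X (u i)" and v: "clopenin Z (v i)" if "i \<in> Fpow L" for i
    unfolding u_def v_def
    by (rule clopenin_Inter; use that clopenin_literals[OF clo] in \<open>force simp: Fpow_def L_def\<close>)+
  have uv: "x \<in> u i \<longleftrightarrow> z \<in> v i" if "matched X Z G x z" "i \<in> Fpow L" for x z i
    using matched_Inter_literals[OF that(1), of i] that unfolding u_def v_def L_def
    by (auto simp: Fpow_def matched_def)
  have "|L| <o \<kappa>"
    unfolding L_def literals_def
    by (intro Un_Cinfinite_bound_strict card_of_image_ordLess G Z.Cinfinite)
  then have I: "|Fpow L| <o \<kappa>"
    by (rule card_of_Fpow_ordLess[OF Z.Cinfinite])
  have sub: "|I'| <o \<kappa>" if "I' \<subseteq> Fpow L" for I'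
    using card_of_mono1[OF that] I ordLeq_ordLess_trans by blast
  have \<S>: "|\<S>| <o \<kappa>" and \<T>: "|\<T>| <o \<kappa>"
    unfolding \<S>_def \<T>_def by (intro card_of_image_ordLess sub; blast)+
  have J: "|J| <o \<kappa>" by (rule sub) (auto simp: J_def)
  \<comment> \<open>A common point would lie in \<open>v i\<close> and \<open>v j\<close>, so its
    partner would lie in \<open>u i\<close> and \<open>u j\<close>, one inside \<open>a\<close> and
    the other outside.\<close>
  have \<S>\<T>: "\<Union>\<S> \<inter> \<Union>\<T> = {}"
  proof (rule ccontr)
    assume "\<Union>\<S> \<inter> \<Union>\<T> \<noteq> {}"
    then obtain z i j where z: "z \<in> v i" "z \<in> v j" and ij: "i \<in> Fpow L" "u i \<subseteq> a" "j \<in> Fpow L" "u j \<inter> a = {}"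
      unfolding \<S>_def \<T>_def by blast
    then obtain x where "matched X Z G x z"
      using G(1) v_def unfolding matching_def by blast
    then show False using uv ij z by blast
  qed
  \<comment> \<open>The union of the forced sets need not be closed, but a single undecided point
    suffices: the complements of the forced sets are fewer than \<kappa> clopen sets around
    it.\<close>
  have "\<exists>w. clopenin Z w \<and> w \<noteq> {} \<and> w \<subseteq> v j - (\<Union>\<S> \<union> \<Union>\<T>)" if j: "j \<in> J" for j
  proof -
    obtain z where z: "z \<in> v j" "z \<notin> \<Union>\<S> \<union> \<Union>\<T>" using j unfolding J_def by blast
    have "|{v j} \<union> (\<lambda>s. topspace Z - s) ` (\<S> \<union> \<T>)| <o \<kappa>"
      by (intro Un_Cinfinite_bound_strict card_of_image_ordLess \<S> \<T> Z.Cinfinite)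
        (use finite_ordLess_Cinfinite[OF Z.Cinfinite, of "{v j}"] in simp)
    then have "\<exists>w. clopenin Z w \<and> w \<noteq> {} \<and> (\<forall>U\<in>{v j} \<union> (\<lambda>s. topspace Z - s) ` (\<S> \<union> \<T>). w \<subseteq> U)"
      using z that v unfolding \<S>_def \<T>_def J_def
      by (intro Z.clopen_in_Inter[of _ z]) (auto intro!: clopenin_compl simp: v_def)
    then obtain w where "clopenin Z w" "w \<noteq> {}" "w \<subseteq> v j" "\<And>s. s \<in> \<S> \<union> \<T> \<Longrightarrow> w \<subseteq> topspace Z - s"
      by auto
    then show ?thesis by blast
  qed
  then obtain w where w: "\<And>j. j \<in> J \<Longrightarrow> clopenin Z (w j) \<and> w j \<noteq> {} \<and> w j \<subseteq> v j - (\<Union>\<S> \<union> \<Union>\<T>)"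
    by metis
  then have w_open: "\<And>j. j \<in> J \<Longrightarrow> openin Z (w j) \<and> w j \<noteq> {}"
    by (auto simp: clopenin_def)
  obtain c d where
      c: "\<And>j. j \<in> J \<Longrightarrow> clopenin Z (c j) \<and> c j \<noteq> {} \<and> c j \<subseteq> w j"
    and d: "\<And>j. j \<in> J \<Longrightarrow> clopenin Z (d j) \<and> d j \<noteq> {} \<and> d j \<subseteq> w j"
    and cd: "\<And>i j. i \<in> J \<Longrightarrow> j \<in> J \<Longrightarrow> c i \<inter> d j = {}"
    using Z.bisect_open_family[of J w, OF J w_open] by blast
  have "\<exists>b. clopenin Z b \<and> \<Union>(\<S> \<union> c ` J) \<subseteq> b \<and> b \<inter> \<Union>(\<T> \<union> d ` J) = {}"
  proof (rule Z.separation)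
    show "clopenin Z S" if "S \<in> \<S> \<union> c ` J" for S
      using that c v by (auto simp: \<S>_def)
    show "clopenin Z S" if "S \<in> \<T> \<union> d ` J" for S
      using that d v by (auto simp: \<T>_def)
    show "|\<S> \<union> c ` J| <o \<kappa>" "|\<T> \<union> d ` J| <o \<kappa>"
      by (intro Un_Cinfinite_bound_strict card_of_image_ordLess \<S> \<T> J Z.Cinfinite)+
    have "c j \<inter> (\<Union>\<S> \<union> \<Union>\<T>) = {}" "d j \<inter> (\<Union>\<S> \<union> \<Union>\<T>) = {}" if "j \<in> J" for j
      using c d w that by blast+
    then show "\<Union>(\<S> \<union> c ` J) \<inter> \<Union>(\<T> \<union> d ` J) = {}"
      using cd \<S>\<T> by blast
  qed
  then obtain b where b': "clopenin Z b" "\<Union>(\<S> \<union> c ` J) \<subseteq> b" "b \<inter> \<Union>(\<T> \<union> d ` J) = {}"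
    by (elim exE conjE)
  then have b: "clopenin Z b" "\<Union>\<S> \<subseteq> b" "b \<inter> \<Union>\<T> = {}"
    by blast+
  have bJ: "c j \<subseteq> b \<and> d j \<inter> b = {}" if "j \<in> J" for j
    using b'(2,3) that by blast
  have backward: "\<exists>x. matched X Z G x z \<and> (x \<in> a \<longleftrightarrow> z \<in> b)" if z: "z \<in> topspace Z" for z
  proof (rule ccontr)
    assume none: "\<nexists>x. matched X Z G x z \<and> (x \<in> a \<longleftrightarrow> z \<in> b)"
    \<comment> \<open>The side of \<open>a\<close> on which the partner of \<open>z\<close> has to
      lie. If no partner lies there, finitely many literals show that a set \<open>v i\<close>
      containing \<open>z\<close> was forced to the other side of \<open>b\<close>.\<close>
    define K where "K = (if z \<in> b then a else topspace X - a)"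
    have K: "closedin X K"
      using a by (auto simp: K_def clopenin_def)
    have clo': "\<forall>(a, b)\<in>G\<inverse>. clopenin Z a \<and> clopenin X b"
      using clo by auto
    have none': "\<not> matched Z X (G\<inverse>) z x" if "x \<in> K" for x
      using none that closedin_subset[OF K] unfolding matched_converse K_def
      by (auto split: if_splits)
    obtain i where i: "i \<in> Fpow (literals Z X (G\<inverse>))" "z \<in> \<Inter>(fst ` i)" "K \<inter> \<Inter>(snd ` i) = {}"
      by (rule separating_literals[OF X clo' K z none'])
    \<comment> \<open>The literals come from the converse relation; turning them around exchanges
      the roles of \<open>u\<close> and \<open>v\<close>.\<close>
    have "fst ` (i\<inverse>) = snd ` i" "snd ` (i\<inverse>) = fst ` i"
      by force+
    then have "u (i\<inverse>) = topspace X \<inter> \<Inter>(snd ` i)" "v (i\<inverse>) = topspace Z \<inter> \<Inter>(fst ` i)"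
      by (simp_all only: u_def v_def)
    moreover have "i\<inverse> \<in> Fpow L"
      using i(1) unfolding literals_converse L_def Fpow_def by auto
    ultimately have i': "i\<inverse> \<in> Fpow L" "z \<in> v (i\<inverse>)" "K \<inter> u (i\<inverse>) = {}"
      using i z by blast+
    show False
    proof (cases "z \<in> b")
      case True
      then have "v (i\<inverse>) \<in> \<T>" using i' by (auto simp: \<T>_def K_def)
      then show False using i' True b by blast
    next
      case False
      then have "u (i\<inverse>) \<subseteq> a" using i' clopenin_subset[OF u[OF i'(1)]] by (auto simp: K_def)
      then have "v (i\<inverse>) \<in> \<S>" using i' by (auto simp: \<S>_def)
      then show False using i' False b by blast
    qed
  qed
  have forward: "\<exists>z. matched X Z G x z \<and> (x \<in> a \<longleftrightarrow> z \<in> b)" if x: "x \<in> topspace X" for x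
  proof (rule ccontr)
    assume none: "\<nexists>z. matched X Z G x z \<and> (x \<in> a \<longleftrightarrow> z \<in> b)"
    define K where "K = (if x \<in> a then b else topspace Z - b)"
    have K: "closedin Z K"
      using b by (auto simp: K_def clopenin_def)
    have none': "\<not> matched X Z G x z" if "z \<in> K" for z
      using none that closedin_subset[OF K] unfolding K_def
      by (auto split: if_splits)
    obtain i where "i \<in> Fpow (literals X Z G)" "x \<in> \<Inter>(fst ` i)" "K \<inter> \<Inter>(snd ` i) = {}"
      by (rule separating_literals[OF Z.compact clo K x none'])
    then have i: "i \<in> Fpow L" "x \<in> u i" "K \<inter> v i = {}"
      using x unfolding L_def by (auto simp: u_def v_def)
    \<comment> \<open>For an index in \<open>J\<close> the sets \<open>c i\<close> and
      \<open>d i\<close> make \<open>v i\<close> meet both \<open>b\<close> and its complement, so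
      \<open>v i\<close> cannot miss \<open>K\<close>.\<close>
    have "i \<notin> J"
    proof
      assume iJ: "i \<in> J"
      then have "c i \<subseteq> b \<inter> v i" "d i \<subseteq> (topspace Z - b) \<inter> v i"
        using bJ[OF iJ] c[OF iJ] d[OF iJ] w[OF iJ] clopenin_subset[of Z "d i"] by blast+
      then show False using c[OF iJ] d[OF iJ] i(3) by (auto simp: K_def split: if_splits)
    qed
    then have "v i \<subseteq> \<Union>\<S> \<union> \<Union>\<T>" using i(1) by (auto simp: J_def)
    moreover obtain z where z: "matched X Z G x z"
      using G(1) x unfolding matching_def by blast
    moreover have "z \<in> v i" using uv[OF z i(1)] i(2) by blast
    ultimately consider j where "j \<in> Fpow L" "u j \<subseteq> a" "z \<in> v j" | j where "j \<in> Fpow L" "u j \<inter> a = {}" "z \<in> v j"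
      unfolding \<S>_def \<T>_def by blast
    \<comment> \<open>So the forced sets put the old partner \<open>z\<close> on the correct side of
      \<open>b\<close>, and \<open>z\<close> still matches \<open>x\<close>.\<close>
    then have "x \<in> a \<longleftrightarrow> z \<in> \<Union>\<S>" "x \<notin> a \<longleftrightarrow> z \<in> \<Union>\<T>"
      using uv[OF z] \<S>\<T> unfolding \<S>_def \<T>_def by (cases; blast)+
    then show False using none z b by blast
  qed
  have "matching X Z (insert (a, b) G)"
    using backward forward clo a b unfolding matching_def matched_insert by simp
  then show ?thesis by (rule that)
qed

section \<open>From matchings to a homeomorphism\<close>

text \<open>When all clopen sets occur in \<open>G\<close>, they separate points, so partners are
  unique on both sides. The preimage of a clopen \<open>b\<close> is the set paired with it, whence
  continuity; a continuous bijection from a compact to a Hausdorff space is a homeomorphism.\<close>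

lemma matching_imp_homeomorphic_space:
  assumes X: "compact_space X" "Hausdorff_space X" "clopen_based X"
    and Z: "Hausdorff_space Z" "clopen_based Z"
    and G: "matching X Z G" "{c. clopenin X c} \<subseteq> Domain G" "{c. clopenin Z c} \<subseteq> Range G"
  shows "X homeomorphic_space Z"
proof -
  obtain f where f: "\<And>x. x \<in> topspace X \<Longrightarrow> matched X Z G x (f x)"
    using G(1) unfolding matching_def by metis
  \<comment> \<open>Kept general in both spaces because injectivity of \<open>f\<close> is the same
    statement for the converse relation.\<close>
  have unique: "z = z'"
    if Z: "Hausdorff_space Z" "clopen_based Z" "{c. clopenin Z c} \<subseteq> Range G"
      and m: "matched X Z G x z" "matched X Z G x z'"
    for X :: "'c topology" and Z :: "'d topology" and G x z z'
  proof (rule ccontr)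
    assume "z \<noteq> z'"
    have "openin Z (topspace Z - {z'})"
      by (rule Hausdorff_openin_topspace_delete[OF Z(1)])
    moreover have "z \<in> topspace Z - {z'}"
      using m \<open>z \<noteq> z'\<close> by (auto simp: matched_def)
    ultimately obtain b where b: "clopenin Z b" "z \<in> b" "b \<subseteq> topspace Z - {z'}"
      by (rule clopen_basedE[OF Z(2)])
    then obtain a where "(a, b) \<in> G" using Z(3) by blast
    then have "z \<in> b \<longleftrightarrow> z' \<in> b"
      using m matchedD by metis
    then show False
      using b by blast
  qed
  have "homeomorphic_map X Z f"
  proof (rule continuous_imp_homeomorphic_map)
    show "continuous_map X Z f"
      unfolding continuous_map_def
    proof (intro conjI allI impI)
      show "f \<in> topspace X \<rightarrow> topspace Z" using f by (auto simp: matched_def)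
      fix V assume V: "openin Z V"
      show "openin X {x \<in> topspace X. f x \<in> V}"
      proof (subst openin_subopen, intro ballI)
        fix x assume x: "x \<in> {x \<in> topspace X. f x \<in> V}"
        then obtain b where b: "clopenin Z b" "f x \<in> b" "b \<subseteq> V"
          using clopen_basedE[OF Z(2) V] by blast
        then obtain a where a: "(a, b) \<in> G" using G(3) by blast
        then have "openin X a" using G(1) by (auto simp: matching_def clopenin_def)
        moreover have "x' \<in> a \<longleftrightarrow> f x' \<in> b" if "x' \<in> topspace X" for x'
          using matchedD[OF f[OF that] a] .
        ultimately show "\<exists>T. openin X T \<and> x \<in> T \<and> T \<subseteq> {x \<in> topspace X. f x \<in> V}"
          using b x openin_subset by (intro exI[of _ a]) blast
      qed
    qed
    show "f ` topspace X = topspace Z"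
    proof (intro equalityI subsetI)
      fix z assume "z \<in> topspace Z"
      then obtain x where x: "matched X Z G x z" using G(1) by (auto simp: matching_def)
      then have "x \<in> topspace X" by (simp add: matched_def)
      moreover from this have "f x = z" using unique[OF Z G(3) f x] by blast
      ultimately show "z \<in> f ` topspace X" by blast
    qed (use f in \<open>auto simp: matched_def\<close>)
    have G': "{c. clopenin X c} \<subseteq> Range (G\<inverse>)" using G(2) by simp
    show "inj_on f (topspace X)"
    proof (rule inj_onI)
      fix x y assume xy: "x \<in> topspace X" "y \<in> topspace X" "f x = f y"
      then show "x = y"
        using unique[OF X(2,3) G', of Z "f x" x y] f[OF xy(1)] f[OF xy(2)] by (simp add: matched_converse)
    qed
  qed (use X Z in auto)
  then show ?thesis
    by (rule homeomorphic_map_imp_homeomorphic_space)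
qed

text \<open>The union step of the recursion. The images of initial segments form a chain, so a
  finite part of the union lies in one of them, and being a matching has finite character. For empty
  \<open>S\<close> the relation is empty and is a matching because both spaces are
  non-empty.\<close>

lemma matching_UN_under:
  assumes r: "Well_order r" and S: "S \<subseteq> Field r"
    and X: "compact_space X" "topspace X \<noteq> {}" and Z: "compact_space Z" "topspace Z \<noteq> {}"
    and f: "\<And>y. y \<in> S \<Longrightarrow> matching X Z (f ` under r y)"
  shows "matching X Z (\<Union>y\<in>S. f ` under r y)"
proof (rule matching_finite_character[OF X(1) Z(1)])
  fix F assume F: "finite F" "F \<subseteq> (\<Union>y\<in>S. f ` under r y)"
  show "matching X Z F"
  proof (cases "S = {}")
    case True
    then have "F = {}" using F by auto
    then show ?thesis using X(2) Z(2) unfolding matching_def matched_def by blast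
  next
    case False
    have tr: "trans r" and tot: "total_on (Field r) r" and re: "refl_on (Field r) r"
      using r by (auto simp: well_order_on_def linear_order_on_def partial_order_on_def preorder_on_def)
    have le: "f ` under r x \<subseteq> f ` under r y" if "(x, y) \<in> r" for x y
      using that tr by (auto simp: under_def elim: transE)
    have "f ` under r x \<subseteq> f ` under r y \<or> f ` under r y \<subseteq> f ` under r x" if "x \<in> S" "y \<in> S" for x y
    proof -
      have "(x, y) \<in> r \<or> (y, x) \<in> r"
        using that S tot re by (cases "x = y") (auto simp: total_on_def refl_on_def)
      then show ?thesis using le by blast
    qed
    then have "subset.chain UNIV ((\<lambda>y. f ` under r y) ` S)"
      by (auto simp: subset_chain_def)
    then obtain B where "B \<in> (\<lambda>y. f ` under r y) ` S" "F \<subseteq> B"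
      using finite_subset_Union_chain[OF F] False by (metis image_is_empty)
    then show ?thesis using f matching_antimono by blast
  qed
qed

text \<open>All clopen sets of both spaces are listed along \<kappa>, and stage \<alpha> supplies a
  partner for the set \<open>e \<alpha>\<close>. Fewer than \<kappa> pairs precede each stage, so
  \<open>extend_matching\<close> applies every time.\<close>

theorem saturated_Stone_space_unique:
  fixes \<kappa> :: "'k rel" and X :: "'a topology" and Z :: "'b topology"
  assumes X: "saturated_Stone_space \<kappa> X" and Z: "saturated_Stone_space \<kappa> Z"
  shows "X homeomorphic_space Z"
proof -
  interpret X: saturated_Stone_space \<kappa> X by (rule X)
  interpret Z: saturated_Stone_space \<kappa> Z by (rule Z)
  let ?A = "{c. clopenin X c} <+> {c. clopenin Z c}"
  have card: "Card_order \<kappa>" and inf: "infinite (Field \<kappa>)"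
    using X.Cinfinite by (auto simp: cinfinite_def)
  have wo: "Well_order \<kappa>" by (rule card_order_on_well_order_on[OF card])
  have "|?A| \<le>o \<kappa>"
    using card_of_Plus_ordLeq_infinite_Field[OF inf X.clopens_card Z.clopens_card card] .
  then have "|?A| \<le>o |Field \<kappa>|"
    using card card_of_Field_ordIso ordIso_symmetric ordLeq_ordIso_trans by blast
  moreover have "?A \<noteq> {}" using clopenin_empty by blast
  ultimately obtain e where e: "e ` Field \<kappa> = ?A"
    using card_of_ordLeq2 by metis
  \<comment> \<open>Vacuous outside the field of \<kappa>, since the recursion produces a function
    on the whole type.\<close>
  define P where "P f \<alpha> r \<longleftrightarrow> (\<alpha> \<in> Field \<kappa> \<longrightarrow> matching X Z (insert r (f ` underS \<kappa> \<alpha>)) \<and>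
      (case e \<alpha> of Inl a \<Rightarrow> fst r = a | Inr b \<Rightarrow> snd r = b))" for f \<alpha> r
  have under: "insert (f \<alpha>) (f ` underS \<kappa> \<alpha>) = f ` under \<kappa> \<alpha>" if "\<alpha> \<in> Field \<kappa>"
    for f :: "'k \<Rightarrow> 'a set \<times> 'b set" and \<alpha>
  proof -
    have "under \<kappa> \<alpha> = insert \<alpha> (underS \<kappa> \<alpha>)"
      using that wo by (auto simp: under_def underS_def order_on_defs refl_on_def)
    then show ?thesis by simp
  qed
  have step: "\<exists>r. P f \<alpha> r" if prev: "\<And>\<beta>. (\<beta>, \<alpha>) \<in> \<kappa> - Id \<Longrightarrow> P f \<beta> (f \<beta>)" for f \<alpha>
  proof (cases "\<alpha> \<in> Field \<kappa>")
    case True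
    \<comment> \<open>Writing the earlier pairs as a union over closed initial segments treats
      successor and limit stages alike.\<close>
    have "matching X Z (f ` under \<kappa> \<beta>)" if "\<beta> \<in> underS \<kappa> \<alpha>" for \<beta>
    proof -
      have "(\<beta>, \<alpha>) \<in> \<kappa> - Id" "\<beta> \<in> Field \<kappa>" using that by (auto simp: underS_def Field_def)
      then show ?thesis using prev[of \<beta>] under[of \<beta> f] by (auto simp: P_def)
    qed
    then have "matching X Z (\<Union>\<beta>\<in>underS \<kappa> \<alpha>. f ` under \<kappa> \<beta>)"
      by (intro matching_UN_under wo X.compact X.nonempty Z.compact Z.nonempty)
        (auto simp: underS_def Field_def)
    moreover have "f ` underS \<kappa> \<alpha> \<subseteq> (\<Union>\<beta>\<in>underS \<kappa> \<alpha>. f ` under \<kappa> \<beta>)"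
      using wo by (fastforce simp: under_def underS_def Field_def order_on_defs refl_on_def)
    ultimately have m: "matching X Z (f ` underS \<kappa> \<alpha>)"
      using matching_antimono by blast
    have c: "|f ` underS \<kappa> \<alpha>| <o \<kappa>"
      by (intro card_of_image_ordLess card_of_underS card True)
    have eA: "e \<alpha> \<in> ?A" using e True by blast
    show ?thesis
    proof (cases "e \<alpha>")
      case (Inl a)
      then have "clopenin X a" using eA by auto
      then obtain b where "matching X Z (insert (a, b) (f ` underS \<kappa> \<alpha>))"
        by (rule extend_matching[OF X.compact Z m c])
      then show ?thesis using Inl by (intro exI[of _ "(a, b)"]) (simp add: P_def)
    next
      case (Inr b)
      then have "clopenin Z b" using eA by auto
      have "R\<inverse> = (\<lambda>(a, b). (b, a)) ` R" for R :: "('a set \<times> 'b set) set"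
        by auto
      then have c': "|(f ` underS \<kappa> \<alpha>)\<inverse>| <o \<kappa>"
        using card_of_image_ordLess[OF c] by metis
      \<comment> \<open>For a clopen set of \<open>Z\<close> the extension lemma is used with the
        spaces exchanged, on the converse relation.\<close>
      have m': "matching Z X ((f ` underS \<kappa> \<alpha>)\<inverse>)"
        unfolding matching_converse by (rule m)
      obtain a where "matching Z X (insert (b, a) ((f ` underS \<kappa> \<alpha>)\<inverse>))"
        by (rule extend_matching[OF Z.compact X m' c' \<open>clopenin Z b\<close>])
      also have "insert (b, a) (R\<inverse>) = (insert (a, b) R)\<inverse>" for R :: "('a set \<times> 'b set) set"
        by auto
      finally have "matching X Z (insert (a, b) (f ` underS \<kappa> \<alpha>))"
        unfolding matching_converse .
      then show ?thesis using Inr by (intro exI[of _ "(a, b)"]) (simp add: P_def)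
    qed
  qed (simp add: P_def)
  have wf: "wf (\<kappa> - Id)" using wo by (simp add: well_order_on_def)
  have local: "P f \<alpha> r = P g \<alpha> r" if "\<And>\<beta>. (\<beta>, \<alpha>) \<in> \<kappa> - Id \<Longrightarrow> f \<beta> = g \<beta>" for f g \<alpha> r
  proof -
    have "f ` underS \<kappa> \<alpha> = g ` underS \<kappa> \<alpha>"
      using that by (intro image_cong) (auto simp: underS_def)
    then show ?thesis by (simp add: P_def)
  qed
  obtain f where f: "\<And>\<alpha>. P f \<alpha> (f \<alpha>)"
    using dependent_wf_choice[of "\<kappa> - Id" P, OF wf local step] by blast
  let ?G = "\<Union>\<alpha>\<in>Field \<kappa>. f ` under \<kappa> \<alpha>"
  have "matching X Z ?G"
    by (intro matching_UN_under wo X.compact X.nonempty Z.compact Z.nonempty)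
      (use f under in \<open>auto simp: P_def\<close>)
  moreover have mem: "f \<alpha> \<in> ?G" if "\<alpha> \<in> Field \<kappa>" for \<alpha>
    using that under[OF that, of f] by blast
  have "{c. clopenin X c} \<subseteq> Domain ?G"
  proof
    fix a assume "a \<in> {c. clopenin X c}"
    then have "Inl a \<in> e ` Field \<kappa>" by (auto simp add: e)
    then obtain \<alpha> where \<alpha>: "\<alpha> \<in> Field \<kappa>" "e \<alpha> = Inl a" by (metis imageE)
    then have "fst (f \<alpha>) = a" using f[of \<alpha>] by (simp add: P_def)
    then show "a \<in> Domain ?G" using mem[OF \<alpha>(1)] by (metis DomainI prod.collapse)
  qed
  moreover have "{c. clopenin Z c} \<subseteq> Range ?G"
  proof
    fix b assume "b \<in> {c. clopenin Z c}"
    then have "Inr b \<in> e ` Field \<kappa>" by (auto simp add: e)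
    then obtain \<alpha> where \<alpha>: "\<alpha> \<in> Field \<kappa>" "e \<alpha> = Inr b" by (metis imageE)
    then have "snd (f \<alpha>) = b" using f[of \<alpha>] by (simp add: P_def)
    then show "b \<in> Range ?G" using mem[OF \<alpha>(1)] by (metis RangeI prod.collapse)
  qed
  ultimately show ?thesis
    by (intro matching_imp_homeomorphic_space X.compact X.Hausdorff X.clopen_based Z.Hausdorff Z.clopen_based)
qed

section \<open>Finite compactifications of a punctured saturated Stone space\<close>

locale punctured_compactification = saturated_Stone_space \<kappa> X
  for \<kappa> :: "'k rel" and X :: "'a topology" +
  fixes x :: 'a and Z :: "'b topology" and e :: "'a \<Rightarrow> 'b"
  assumes x_in: "x \<in> topspace X"
    and finite_comp: "finite_compactification (subtopology X (topspace X - {x})) Z e"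
begin

section \<open>Transfer of open and clopen sets between the two spaces\<close>

abbreviation Y :: "'a topology" where "Y \<equiv> subtopology X (topspace X - {x})"

definition E :: "'b set" where "E = e ` (topspace X - {x})"

text \<open>Restricted to the punctured space because \<open>e\<close> is meaningful only there; its
  value at \<open>x\<close> is arbitrary.\<close>

definition pullback :: "'b set \<Rightarrow> 'a set"
  where "pullback V = {y \<in> topspace X - {x}. e y \<in> V}"

lemma topspace_Y [simp]: "topspace Y = topspace X - {x}"
  by auto

lemma remainder_eq: "remainder Y Z e = topspace Z - E"
  by (simp only: remainder_def E_def topspace_Y)

lemma finite_remainder: "finite (topspace Z - E)"
  and compact_Z: "compact_space Z" and Hausdorff_Z: "Hausdorff_space Z"
  and dense_E: "Z closure_of E = topspace Z"
  and embedding: "homeomorphic_map Y (subtopology Z E) e"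
  using finite_comp
  by (simp_all only: finite_compactification_def embedding_map_def remainder_eq topspace_Y E_def[symmetric])

lemma continuous_e: "continuous_map Y Z e"
  using homeomorphic_imp_continuous_map[OF embedding] unfolding continuous_map_in_subtopology
  by (rule conjunct1)

lemma E_subset: "E \<subseteq> topspace Z"
  using continuous_map_image_subset_topspace[OF continuous_e] by (simp only: E_def topspace_Y)

lemma inj_e: "inj_on e (topspace X - {x})"
  using homeomorphic_imp_injective_map[OF embedding] by (simp only: topspace_Y)

lemma open_Y: "openin X (topspace X - {x})"
  by (rule Hausdorff_openin_topspace_delete[OF Hausdorff])

lemma open_E: "openin Z E"
proof -
  have "closedin Z (topspace Z - E)"
    by (intro closedin_Hausdorff_finite Hausdorff_Z finite_remainder) auto
  then show ?thesis
    using E_subset openin_closedin by blast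
qed

lemma image_subset_E: "U \<subseteq> topspace X - {x} \<Longrightarrow> e ` U \<subseteq> E"
  unfolding E_def by (rule image_mono)

lemma image_pullback: "V \<subseteq> E \<Longrightarrow> e ` pullback V = V"
  unfolding E_def pullback_def by blast

lemma pullback_subset: "pullback V \<subseteq> topspace X - {x}"
  unfolding pullback_def by blast

lemma pullback_image: "U \<subseteq> topspace X - {x} \<Longrightarrow> pullback (e ` U) = U"
  unfolding pullback_def using inj_on_image_mem_iff[OF inj_e] by blast

lemma open_image:
  assumes "openin X U" "x \<notin> U"
  shows "openin Z (e ` U)"
proof -
  have "openin Y U"
    using assms openin_subset open_Y by (auto simp: openin_open_subtopology)
  then have "openin (subtopology Z E) (e ` U)"
    using homeomorphic_imp_open_map[OF embedding] open_map_def by blast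
  then show ?thesis
    using openin_open_subtopology[OF open_E] by blast
qed

lemma open_pullback:
  assumes "openin Z V"
  shows "openin X (pullback V)"
proof -
  have "openin Y {y \<in> topspace Y. e y \<in> V}"
    by (rule openin_continuous_map_preimage[OF continuous_e assms])
  then show ?thesis
    unfolding topspace_Y pullback_def using openin_open_subtopology[OF open_Y] by blast
qed

text \<open>A clopen set that misses \<open>x\<close> is compact in \<open>Y\<close>, so its image
  is compact and therefore closed in all of \<open>Z\<close>, not just in \<open>E\<close>.\<close>

lemma clopen_image:
  assumes "clopenin X c" "x \<notin> c"
  shows "clopenin Z (e ` c)"
proof -
  have "compactin Y c"
    using assms clopenin_subset[OF assms(1)] closedin_compact_space[OF compact]
    by (auto simp: compactin_subtopology clopenin_def)
  then have "compactin Z (e ` c)"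
    by (rule image_compactin[OF _ continuous_e])
  then show ?thesis
    using assms open_image compactin_imp_closedin[OF Hausdorff_Z] by (auto simp: clopenin_def)
qed

lemma clopen_pullback:
  assumes "clopenin Z V" "V \<subseteq> E"
  shows "clopenin X (pullback V)"
proof -
  have "compactin (subtopology Z E) V"
    using assms closedin_compact_space[OF compact_Z] by (auto simp: compactin_subtopology clopenin_def)
  then have "compactin Y (pullback V)"
    unfolding homeomorphic_map_compactness_eq[OF embedding] topspace_Y
    using assms image_pullback pullback_subset by metis
  then have "compactin X (pullback V)"
    by (simp add: compactin_subtopology)
  then show ?thesis
    using assms open_pullback compactin_imp_closedin[OF Hausdorff] by (auto simp: clopenin_def)
qed

lemma clopen_based_E:
  assumes "openin Z U" "z \<in> U" "z \<in> E"
  shows "\<exists>c. clopenin Z c \<and> z \<in> c \<and> c \<subseteq> U \<inter> E"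
proof -
  obtain y where y: "y \<in> topspace X - {x}" "e y = z"
    using assms(3) unfolding E_def by blast
  then have "y \<in> pullback U" using assms by (auto simp: pullback_def)
  then obtain c where c: "clopenin X c" "y \<in> c" "c \<subseteq> pullback U"
    by (rule clopen_basedE[OF clopen_based open_pullback[OF assms(1)]])
  then have "x \<notin> c" "e ` c \<subseteq> U \<inter> E"
    unfolding pullback_def E_def by blast+
  then show ?thesis
    using clopen_image[OF c(1)] c(2) y(2) by blast
qed

lemma clopen_around_compact_in_E:
  assumes "closedin Z K" "K \<subseteq> E"
  obtains c where "clopenin Z c" "K \<subseteq> c" "c \<subseteq> E"
  using clopen_between_compactin_open[OF closedin_compact_space[OF compact_Z assms(1)] open_E assms(2)]
    clopen_based_E[OF open_E] assms(2) by (metis Int_absorb subsetD)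

text \<open>At points of \<open>E\<close> this is inherited from \<open>X\<close>. For a remainder
  point \<open>p\<close>, take an open \<open>V\<close> inside a closed \<open>D\<close> that
  contains no other remainder point. The closed set \<open>D - V\<close> lies in \<open>E\<close>
  and so in a clopen \<open>c\<close> inside \<open>E\<close>; removing \<open>c\<close> makes
  \<open>V - c\<close> and \<open>D - c\<close> equal, hence clopen.\<close>

lemma clopen_based_Z: "clopen_based Z"
  unfolding clopen_based_def
proof (intro allI impI, elim conjE)
  fix U p assume U: "openin Z U" "p \<in> U"
  have p: "p \<in> topspace Z" using U openin_subset by blast
  show "\<exists>c. clopenin Z c \<and> p \<in> c \<and> c \<subseteq> U"
  proof (cases "p \<in> E")
    case True
    then show ?thesis using clopen_based_E[OF U] by blast
  next
    case False
    have "closedin Z (topspace Z - E - {p})"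
      by (intro closedin_Hausdorff_finite Hausdorff_Z finite_Diff finite_remainder) auto
    then have "openin Z (U - (topspace Z - E - {p}))"
      using U(1) by (rule openin_diff[rotated])
    moreover have "neighbourhood_base_of (closedin Z) Z"
      unfolding neighbourhood_base_of_closedin
      by (rule compact_Hausdorff_imp_regular_space[OF compact_Z Hausdorff_Z])
    moreover have "p \<in> U - (topspace Z - E - {p})" using U by blast
    ultimately obtain V D where VD: "openin Z V" "closedin Z D" "p \<in> V" "V \<subseteq> D"
        "D \<subseteq> U - (topspace Z - E - {p})"
      unfolding neighbourhood_base_of by meson
    have "closedin Z (D - V)" using VD by (intro closedin_diff)
    moreover have "D - V \<subseteq> E"
      using VD closedin_subset[OF VD(2)] by blast
    ultimately obtain c where c: "clopenin Z c" "D - V \<subseteq> c" "c \<subseteq> E"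
      by (rule clopen_around_compact_in_E)
    have "D - c = V - c" using c VD by blast
    moreover have "closedin Z (D - c)" "openin Z (V - c)"
      using c VD by (auto simp: clopenin_def)
    ultimately have "clopenin Z (V - c)" by (simp add: clopenin_def)
    moreover have "p \<in> V - c" "V - c \<subseteq> U"
      using VD c False by blast+
    ultimately show ?thesis by blast
  qed
qed

section \<open>Small families of clopen sets near the remainder\<close>

lemma meets_E: "openin Z U \<Longrightarrow> U \<noteq> {} \<Longrightarrow> U \<inter> E \<noteq> {}"
  using dense_intersects_open[of Z E] dense_E by blast

lemma clopen_isolating_remainder_point:
  assumes "z \<in> topspace Z"
  shows "\<exists>N. clopenin Z N \<and> z \<in> N \<and> N \<subseteq> insert z E"
proof -
  have "closedin Z (topspace Z - E - {z})"
    by (intro closedin_Hausdorff_finite Hausdorff_Z finite_Diff finite_remainder) auto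
  then have "openin Z (topspace Z - (topspace Z - E - {z}))" by blast
  then obtain N where N: "clopenin Z N" "z \<in> N" "N \<subseteq> topspace Z - (topspace Z - E - {z})"
    by (rule clopen_basedE[OF clopen_based_Z]) (use assms in auto)
  then have "N \<subseteq> insert z E" by blast
  with N show ?thesis by blast
qed

text \<open>Separating the preimages in \<open>X\<close>, the point \<open>x\<close> falls on one side only, and the other side is
  bounded away from the remainder.\<close>

lemma one_side_bounded:
  assumes \<S>: "\<And>S. S \<in> \<S> \<Longrightarrow> clopenin Z S \<and> S \<subseteq> E" and \<T>: "\<And>T. T \<in> \<T> \<Longrightarrow> clopenin Z T \<and> T \<subseteq> E"
    and card: "|\<S>| <o \<kappa>" "|\<T>| <o \<kappa>" and disj: "\<Union>\<S> \<inter> \<Union>\<T> = {}"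
  shows "\<exists>C. clopenin Z C \<and> C \<subseteq> E \<and>
    (\<Union>\<S> \<subseteq> C \<and> C \<inter> \<Union>\<T> = {} \<or> \<Union>\<T> \<subseteq> C \<and> C \<inter> \<Union>\<S> = {})"
proof -
  have "\<exists>c. clopenin X c \<and> \<Union>(pullback ` \<S>) \<subseteq> c \<and> c \<inter> \<Union>(pullback ` \<T>) = {}"
  proof (rule separation)
    show "clopenin X S" if "S \<in> pullback ` \<S>" for S
      using that \<S> clopen_pullback by blast
    show "clopenin X S" if "S \<in> pullback ` \<T>" for S
      using that \<T> clopen_pullback by blast
    show "\<Union>(pullback ` \<S>) \<inter> \<Union>(pullback ` \<T>) = {}"
      using disj unfolding pullback_def by blast
  qed (intro card_of_image_ordLess card)+
  then obtain c where c: "clopenin X c" "\<Union>(pullback ` \<S>) \<subseteq> c" "c \<inter> \<Union>(pullback ` \<T>) = {}"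
    by (elim exE conjE)
  have \<S>c: "z \<in> e ` (c - {x})" if z: "z \<in> \<Union>\<S>" for z
  proof -
    obtain S where S: "S \<in> \<S>" "z \<in> S" using z by blast
    have "z \<in> e ` pullback S"
      using image_pullback[of S] \<S>[OF S(1)] S(2) by simp
    then obtain y where "y \<in> pullback S" "e y = z" by blast
    then show ?thesis using S(1) c(2) pullback_subset[of S] by blast
  qed
  have \<T>c: "z \<in> e ` (topspace X - c - {x})" if z: "z \<in> \<Union>\<T>" for z
  proof -
    obtain T where T: "T \<in> \<T>" "z \<in> T" using z by blast
    have "z \<in> e ` pullback T"
      using image_pullback[of T] \<T>[OF T(1)] T(2) by simp
    then obtain y where "y \<in> pullback T" "e y = z" by blast
    then show ?thesis using T(1) c(3) pullback_subset[of T] by blast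
  qed
  have "e ` (c - {x}) \<inter> e ` (topspace X - c - {x}) = {}"
    using inj_on_image_Int[OF inj_e, of "c - {x}" "topspace X - c - {x}"] clopenin_subset[OF c(1)] by blast
  show ?thesis
  proof (cases "x \<in> c")
    case False
    have "e ` c \<subseteq> E" by (rule image_subset_E) (use clopenin_subset[OF c(1)] False in blast)
    moreover have "c - {x} = c" using False by blast
    ultimately show ?thesis
      using clopen_image[OF c(1) False] \<S>c \<T>c \<open>e ` (c - {x}) \<inter> _ = {}\<close>
      by (intro exI[of _ "e ` c"]) (simp, blast)
  next
    case True
    have "e ` (topspace X - c) \<subseteq> E" by (rule image_subset_E) (use True in blast)
    moreover have "topspace X - c - {x} = topspace X - c" using True by blast
    moreover have "clopenin Z (e ` (topspace X - c))"
      by (rule clopen_image[OF clopenin_compl[OF c(1)]]) (use True in blast)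
    ultimately show ?thesis
      using \<S>c \<T>c \<open>e ` (c - {x}) \<inter> _ = {}\<close>
      by (intro exI[of _ "e ` (topspace X - c)"]) (simp, blast)
  qed
qed

text \<open>Carried over from \<open>X\<close>. Cutting every member down to the image of a clopen
  \<open>V\<close> that avoids \<open>x\<close> keeps it inside \<open>E\<close>, where pullbacks of
  clopen sets are clopen.\<close>

lemma clopen_in_Inter_E:
  assumes \<U>: "\<And>U. U \<in> \<U> \<Longrightarrow> clopenin Z U \<and> z \<in> U" and z: "z \<in> E" and card: "|\<U>| <o \<kappa>"
  shows "\<exists>c. clopenin Z c \<and> c \<noteq> {} \<and> (\<forall>U\<in>\<U>. c \<subseteq> U)"
proof -
  obtain y where y: "y \<in> topspace X - {x}" "e y = z"
    using z unfolding E_def by blast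
  obtain V where V: "clopenin X V" "y \<in> V" "V \<subseteq> topspace X - {x}"
    by (rule clopen_basedE[OF clopen_based open_Y y(1)])
  have eV: "clopenin Z (e ` V)" "e ` V \<subseteq> E"
    using V clopen_image image_subset_E by blast+
  have "\<exists>c. clopenin X c \<and> c \<noteq> {} \<and> (\<forall>U\<in>{V} \<union> (\<lambda>U. pullback (U \<inter> e ` V)) ` \<U>. c \<subseteq> U)"
  proof (rule clopen_in_Inter[of _ y])
    show "|{V} \<union> (\<lambda>U. pullback (U \<inter> e ` V)) ` \<U>| <o \<kappa>"
      by (intro Un_Cinfinite_bound_strict card_of_image_ordLess card Cinfinite)
        (use finite_ordLess_Cinfinite[OF Cinfinite, of "{V}"] in simp)
    show "clopenin X U \<and> y \<in> U" if U: "U \<in> {V} \<union> (\<lambda>U. pullback (U \<inter> e ` V)) ` \<U>" for U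
    proof -
      have "clopenin X (pullback (U \<inter> e ` V)) \<and> y \<in> pullback (U \<inter> e ` V)" if "U \<in> \<U>" for U
      proof
        show "clopenin X (pullback (U \<inter> e ` V))"
          using \<U>[OF that] eV by (intro clopen_pullback clopenin_Int) auto
        show "y \<in> pullback (U \<inter> e ` V)"
          using \<U>[OF that] y V(2) by (auto simp: pullback_def)
      qed
      then show ?thesis using U V by blast
    qed
    show "y \<in> topspace X" using y by blast
  qed
  then obtain c where c: "clopenin X c" "c \<noteq> {}" "c \<subseteq> V" "\<And>U. U \<in> \<U> \<Longrightarrow> c \<subseteq> pullback (U \<inter> e ` V)"
    by auto
  have "clopenin Z (e ` c)" using c V by (intro clopen_image) blast+
  moreover have "e ` c \<subseteq> U" if "U \<in> \<U>" for U
    using c(4)[OF that] unfolding pullback_def by blast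
  ultimately show ?thesis using c(2) by blast
qed

text \<open>A remainder point that is by itself the intersection of fewer than \<open>\<kappa>\<close> clopen sets would be
  approached by two disjoint unions of fewer than \<open>\<kappa>\<close> clopen sets.\<close>

lemma Inter_meets_E:
  assumes \<U>: "\<And>U. U \<in> \<U> \<Longrightarrow> clopenin Z U \<and> z \<in> U" and z: "z \<in> topspace Z" and card: "|\<U>| <o \<kappa>"
  shows "\<exists>y\<in>E. \<forall>U\<in>\<U>. y \<in> U"
proof (rule ccontr)
  assume none: "\<not> (\<exists>y\<in>E. \<forall>U\<in>\<U>. y \<in> U)"
  let ?W = "\<lambda>F. pullback (topspace Z \<inter> \<Inter>F)"
  have W: "openin X (?W F) \<and> ?W F \<noteq> {}" if F: "F \<in> Fpow \<U>" for F
  proof -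
    have F': "finite F" "F \<subseteq> \<U>" using F by (auto simp: Fpow_def)
    then have "clopenin Z (topspace Z \<inter> \<Inter>F)"
      using \<U> by (intro clopenin_Inter) auto
    then have op: "openin Z (topspace Z \<inter> \<Inter>F)" by (simp add: clopenin_def)
    moreover have "z \<in> topspace Z \<inter> \<Inter>F" using z \<U> F' by blast
    ultimately have "(topspace Z \<inter> \<Inter>F) \<inter> E \<noteq> {}" using meets_E by blast
    then have "?W F \<noteq> {}" unfolding pullback_def E_def by blast
    then show ?thesis using open_pullback[OF op] by blast
  qed
  have cardF: "|Fpow \<U>| <o \<kappa>"
    by (rule card_of_Fpow_ordLess[OF Cinfinite card])
  \<comment> \<open>Both families reach into every finite intersection of members of
    \<open>\<U>\<close>, yet their unions are disjoint.\<close>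
  obtain c d where
      c: "\<forall>F\<in>Fpow \<U>. clopenin X (c F) \<and> c F \<noteq> {} \<and> c F \<subseteq> ?W F"
    and d: "\<forall>F\<in>Fpow \<U>. clopenin X (d F) \<and> d F \<noteq> {} \<and> d F \<subseteq> ?W F"
    and cd: "\<forall>F\<in>Fpow \<U>. \<forall>F'\<in>Fpow \<U>. c F \<inter> d F' = {}"
    using bisect_open_family[of "Fpow \<U>" ?W, OF cardF W] by blast
  have push: "clopenin Z (e ` a) \<and> e ` a \<subseteq> E \<and> e ` a \<noteq> {} \<and> e ` a \<subseteq> \<Inter>F"
    if "clopenin X a \<and> a \<noteq> {} \<and> a \<subseteq> ?W F" for a F
  proof -
    have "a \<subseteq> topspace X - {x}" using that pullback_subset by blast
    then have "clopenin Z (e ` a)" "e ` a \<subseteq> E"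
      using that clopen_image image_subset_E by blast+
    moreover have "e ` a \<subseteq> \<Inter>F" using that unfolding pullback_def by blast
    ultimately show ?thesis using that by blast
  qed
  \<comment> \<open>\<open>C\<close> is compact and misses the whole intersection, hence already
    some finite one, although the set chosen for that finite intersection is non-empty and lies in
    \<open>C\<close>.\<close>
  have bounded: False
    if C: "clopenin Z C" "C \<subseteq> E" and a: "\<forall>F\<in>Fpow \<U>. clopenin X (a F) \<and> a F \<noteq> {} \<and> a F \<subseteq> ?W F"
      and sub: "\<Union>((\<lambda>F. e ` a F) ` Fpow \<U>) \<subseteq> C" for C a
  proof -
    have "closedin Z C" using C by (simp add: clopenin_def)
    moreover have "\<And>U. U \<in> \<U> \<Longrightarrow> closedin Z U" using \<U> by (auto simp: clopenin_def)
    moreover have "C \<inter> \<Inter>\<U> = {}" using none C by blast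
    ultimately obtain F where F: "finite F" "F \<subseteq> \<U>" "C \<inter> \<Inter>F = {}"
      by (rule compact_space_finite_Inter_empty[OF compact_Z])
    then have FU: "F \<in> Fpow \<U>" by (auto simp: Fpow_def)
    then have "e ` a F \<subseteq> C" using sub by blast
    moreover have "e ` a F \<noteq> {} \<and> e ` a F \<subseteq> \<Inter>F" using push a FU by blast
    ultimately show False using F(3) by blast
  qed
  let ?\<S> = "(\<lambda>F. e ` c F) ` Fpow \<U>" and ?\<T> = "(\<lambda>F. e ` d F) ` Fpow \<U>"
  have "\<exists>C. clopenin Z C \<and> C \<subseteq> E \<and> (\<Union>?\<S> \<subseteq> C \<and> C \<inter> \<Union>?\<T> = {} \<or> \<Union>?\<T> \<subseteq> C \<and> C \<inter> \<Union>?\<S> = {})"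
  proof (rule one_side_bounded)
    show "clopenin Z S \<and> S \<subseteq> E" if "S \<in> ?\<S>" for S using that c push by blast
    show "clopenin Z S \<and> S \<subseteq> E" if "S \<in> ?\<T>" for S using that d push by blast
    show "|?\<S>| <o \<kappa>" "|?\<T>| <o \<kappa>" by (intro card_of_image_ordLess cardF)+
    have "e ` c F \<inter> e ` d F' = {}" if "F \<in> Fpow \<U>" "F' \<in> Fpow \<U>" for F F'
    proof -
      have "c F \<subseteq> topspace X - {x}" "d F' \<subseteq> topspace X - {x}"
        using c d that pullback_subset by blast+
      then have "e ` (c F \<inter> d F') = e ` c F \<inter> e ` d F'"
        by (rule inj_on_image_Int[OF inj_e])
      then show ?thesis using cd that by simp
    qed
    then show "\<Union>?\<S> \<inter> \<Union>?\<T> = {}" by blast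
  qed
  then obtain C where C: "clopenin Z C" "C \<subseteq> E"
    and C': "\<Union>?\<S> \<subseteq> C \<and> C \<inter> \<Union>?\<T> = {} \<or> \<Union>?\<T> \<subseteq> C \<and> C \<inter> \<Union>?\<S> = {}"
    by (elim exE conjE)
  from C' show False
    using bounded[OF C c] bounded[OF C d] by (elim disjE conjE)
qed

text \<open>A common closure point \<open>z\<close> lies in no member of either family. Inside a
  clopen \<open>N\<close> whose only possible remainder point is \<open>z\<close>, all members
  therefore become subsets of \<open>E\<close>, and \<open>one_side_bounded\<close> separates them
  by a clopen set. On whichever side \<open>z\<close> falls, it has a neighbourhood missing one
  family.\<close>

lemma closures_disjoint:
  assumes \<S>: "\<And>S. S \<in> \<S> \<Longrightarrow> clopenin Z S" and \<T>: "\<And>T. T \<in> \<T> \<Longrightarrow> clopenin Z T"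
    and card: "|\<S>| <o \<kappa>" "|\<T>| <o \<kappa>" and disj: "\<Union>\<S> \<inter> \<Union>\<T> = {}"
  shows "Z closure_of (\<Union>\<S>) \<inter> Z closure_of (\<Union>\<T>) = {}"
proof (rule ccontr)
  assume "Z closure_of (\<Union>\<S>) \<inter> Z closure_of (\<Union>\<T>) \<noteq> {}"
  then obtain z where zST: "z \<in> Z closure_of (\<Union>\<S>)" "z \<in> Z closure_of (\<Union>\<T>)" by blast
  then have z: "z \<in> topspace Z" unfolding in_closure_of by blast
  have zS: "\<exists>S\<in>\<S>. S \<inter> V \<noteq> {}" if "z \<in> V" "openin Z V" for V
    using zST(1) that unfolding in_closure_of by blast
  have zT: "\<exists>T\<in>\<T>. T \<inter> V \<noteq> {}" if "z \<in> V" "openin Z V" for V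
    using zST(2) that unfolding in_closure_of by blast
  obtain N where N: "clopenin Z N" "z \<in> N" "N \<subseteq> insert z E"
    using clopen_isolating_remainder_point[OF z] by blast
  have notS: "z \<notin> S" if "S \<in> \<S>" for S
    using zT[of S] \<S>[OF that] disj that by (auto simp: clopenin_def)
  have notT: "z \<notin> T" if "T \<in> \<T>" for T
    using zS[of T] \<T>[OF that] disj that by (auto simp: clopenin_def)
  let ?\<S> = "(\<lambda>S. S \<inter> N) ` \<S>" and ?\<T> = "(\<lambda>T. T \<inter> N) ` \<T>"
  have "\<exists>C. clopenin Z C \<and> C \<subseteq> E \<and> (\<Union>?\<S> \<subseteq> C \<and> C \<inter> \<Union>?\<T> = {} \<or> \<Union>?\<T> \<subseteq> C \<and> C \<inter> \<Union>?\<S> = {})"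
  proof (rule one_side_bounded)
    show "clopenin Z S \<and> S \<subseteq> E" if "S \<in> ?\<S>" for S
      using that \<S> notS N clopenin_Int[OF _ N(1)] by blast
    show "clopenin Z T \<and> T \<subseteq> E" if "T \<in> ?\<T>" for T
      using that \<T> notT N clopenin_Int[OF _ N(1)] by blast
    show "|?\<S>| <o \<kappa>" "|?\<T>| <o \<kappa>" by (intro card_of_image_ordLess card)+
    show "\<Union>?\<S> \<inter> \<Union>?\<T> = {}" using disj by blast
  qed
  then obtain C where C: "clopenin Z C"
    and C': "\<Union>?\<S> \<subseteq> C \<and> C \<inter> \<Union>?\<T> = {} \<or> \<Union>?\<T> \<subseteq> C \<and> C \<inter> \<Union>?\<S> = {}"
    by (elim exE conjE)
  have op: "openin Z (N \<inter> C)" "openin Z (N - C)"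
    using N(1) C by (auto simp: clopenin_def)
  show False
  proof (cases "z \<in> C")
    case True
    then have "z \<in> N \<inter> C" using N by blast
    then show False using zS[OF _ op(1)] zT[OF _ op(1)] C' by blast
  next
    case False
    then have "z \<in> N - C" using N by blast
    then show False using zS[OF _ op(2)] zT[OF _ op(2)] C' by blast
  qed
qed

section \<open>Saturation of the compactification\<close>

lemma clopens_in_E_card: "|{c. clopenin Z c \<and> c \<subseteq> E}| \<le>o \<kappa>"
proof -
  have "{c. clopenin Z c \<and> c \<subseteq> E} \<subseteq> (\<lambda>c. e ` c) ` {c. clopenin X c}"
  proof
    fix c assume c: "c \<in> {c. clopenin Z c \<and> c \<subseteq> E}"
    then have "e ` pullback c = c" using image_pullback by blast
    moreover have "clopenin X (pullback c)" using c clopen_pullback by blast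
    ultimately show "c \<in> (\<lambda>c. e ` c) ` {c. clopenin X c}"
      by (metis image_eqI mem_Collect_eq)
  qed
  then have "|{c. clopenin Z c \<and> c \<subseteq> E}| \<le>o |(\<lambda>c. e ` c) ` {c. clopenin X c}|"
    by (rule card_of_mono1)
  also have "|(\<lambda>c. e ` c) ` {c. clopenin X c}| \<le>o |{c. clopenin X c}|"
    by (rule card_of_image)
  also note clopens_card
  finally show ?thesis .
qed

text \<open>The finite remainder allows only finitely many traces. Two clopen sets with the same
  trace differ by a clopen subset of \<open>E\<close>, so symmetric difference with a fixed member
  injects each class into the clopen subsets of \<open>E\<close>.\<close>

lemma clopens_Z_card: "|{c. clopenin Z c}| \<le>o \<kappa>"
proof -
  let ?R = "topspace Z - E"
  let ?A = "\<lambda>P. {c. clopenin Z c \<and> c - E = P}"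
  have "|?A P| \<le>o \<kappa>" for P
  proof (cases "?A P = {}")
    case True
    then have "|?A P| <o \<kappa>"
      by (intro finite_ordLess_Cinfinite Cinfinite) (simp only: finite.emptyI)
    then show ?thesis by (rule ordLess_imp_ordLeq)
  next
    case False
    then obtain c0 where c0: "clopenin Z c0" "c0 - E = P" by blast
    let ?\<Delta> = "\<lambda>c. (c - c0) \<union> (c0 - c)"
    have "inj_on ?\<Delta> (?A P)"
      by (rule inj_onI) blast
    moreover have "?\<Delta> ` ?A P \<subseteq> {c. clopenin Z c \<and> c \<subseteq> E}"
    proof (rule image_subsetI)
      fix c assume "c \<in> ?A P"
      then have "clopenin Z (?\<Delta> c)" "?\<Delta> c \<subseteq> E"
        using c0 by (auto intro!: clopenin_Un clopenin_diff)
      then show "?\<Delta> c \<in> {c. clopenin Z c \<and> c \<subseteq> E}" by blast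
    qed
    ultimately have "|?A P| \<le>o |{c. clopenin Z c \<and> c \<subseteq> E}|"
      by (intro iffD1[OF card_of_ordLeq] exI[of _ ?\<Delta>] conjI)
    then show ?thesis using clopens_in_E_card by (rule ordLeq_transitive)
  qed
  moreover have "|Pow ?R| \<le>o \<kappa>"
    using finite_ordLess_Cinfinite[OF Cinfinite, of "Pow ?R"] finite_remainder ordLess_imp_ordLeq by blast
  ultimately have "|\<Union>P\<in>Pow ?R. ?A P| \<le>o \<kappa>"
    by (intro UNION_Cinfinite_bound Cinfinite) auto
  moreover have "{c. clopenin Z c} \<subseteq> (\<Union>P\<in>Pow ?R. ?A P)"
    using clopenin_subset by fastforce
  ultimately show ?thesis
    using card_of_mono1 ordLeq_transitive by blast
qed

text \<open>An isolated point would lie in the dense set \<open>E\<close> and pull back to an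
  isolated point of \<open>X\<close>. For small intersections, \<open>Inter_meets_E\<close> moves
  the common point into \<open>E\<close>; separation follows from disjointness of closures.\<close>

lemma saturated_Z: "saturated_Stone_space \<kappa> Z"
proof
  show "Cinfinite \<kappa>" by (rule Cinfinite)
  show "compact_space Z" by (rule compact_Z)
  show "Hausdorff_space Z" by (rule Hausdorff_Z)
  show "clopen_based Z" by (rule clopen_based_Z)
  show "|{c. clopenin Z c}| \<le>o \<kappa>" by (rule clopens_Z_card)
  have "topspace X \<noteq> {x}"
    using not_isolated[of x] openin_topspace[of X] by metis
  then have "E \<noteq> {}" using x_in unfolding E_def by blast
  then show "topspace Z \<noteq> {}" using E_subset by blast
  show "\<not> openin Z {z}" for z
  proof
    assume op: "openin Z {z}"
    then have "z \<in> E" using meets_E[of "{z}"] by blast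
    then obtain y where "y \<in> topspace X - {x}" "e y = z" unfolding E_def by blast
    then have "pullback {z} = {y}"
      using pullback_image[of "{y}"] by simp
    then show False using open_pullback[OF op] not_isolated by simp
  qed
  show "\<exists>c. clopenin Z c \<and> c \<noteq> {} \<and> (\<forall>U\<in>\<U>. c \<subseteq> U)"
    if \<U>: "\<And>U. U \<in> \<U> \<Longrightarrow> clopenin Z U \<and> z \<in> U" and z: "z \<in> topspace Z" and card: "|\<U>| <o \<kappa>" for \<U> z
  proof -
    obtain y where "y \<in> E" "\<forall>U\<in>\<U>. y \<in> U"
      using Inter_meets_E[of \<U>, OF \<U> z card] by blast
    then show ?thesis
      using \<U> by (intro clopen_in_Inter_E[of \<U> y] card) auto
  qed
  show "\<exists>c. clopenin Z c \<and> \<Union>\<S> \<subseteq> c \<and> c \<inter> \<Union>\<T> = {}"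
    if \<S>: "\<And>S. S \<in> \<S> \<Longrightarrow> clopenin Z S" and \<T>: "\<And>T. T \<in> \<T> \<Longrightarrow> clopenin Z T"
      and card: "|\<S>| <o \<kappa>" "|\<T>| <o \<kappa>" and disj: "\<Union>\<S> \<inter> \<Union>\<T> = {}" for \<S> \<T>
  proof -
    have "\<Union>\<S> \<subseteq> topspace Z" "\<Union>\<T> \<subseteq> topspace Z"
      using \<S> \<T> clopenin_subset by blast+
    then show ?thesis
      using clopen_separation_of_disjoint_closures[OF compact_Z clopen_based_Z, of "\<Union>\<S>" "\<Union>\<T>"]
        closures_disjoint[OF \<S> \<T> card disj] by metis
  qed
qed

section \<open>Remainder points that are not P-points\<close>

text \<open>Shrink the neighbourhoods witnessing the failure to clopen sets \<open>c N\<close> and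
  take the differences \<open>D - c N\<close>, which lie in \<open>E\<close>. If a clopen
  \<open>C\<close> inside \<open>E\<close> contained them all, \<open>D - C\<close> would be a
  neighbourhood of \<open>p\<close> inside every \<open>N\<close>.\<close>

lemma not_P_point_unbounded_family:
  assumes p: "p \<in> topspace Z - E" and notP: "\<not> P_point \<kappa> Z p"
    and D: "clopenin Z D" "p \<in> D" "D \<subseteq> insert p E"
  obtains \<S> where "\<And>S. S \<in> \<S> \<Longrightarrow> clopenin Z S \<and> S \<subseteq> D \<inter> E" "|\<S>| <o \<kappa>"
    "\<And>C. clopenin Z C \<Longrightarrow> C \<subseteq> E \<Longrightarrow> \<not> \<Union>\<S> \<subseteq> C"
proof -
  obtain \<N> where \<N>: "\<And>N. N \<in> \<N> \<Longrightarrow> neighbourhood_in Z p N" "|\<N>| <o \<kappa>"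
    and none: "\<And>U. openin Z U \<Longrightarrow> p \<in> U \<Longrightarrow> \<not> U \<subseteq> \<Inter>\<N>"
    using notP p unfolding P_point_def by blast
  have "\<exists>c. clopenin Z c \<and> p \<in> c \<and> c \<subseteq> N" if N: "N \<in> \<N>" for N
  proof -
    obtain U where U: "openin Z U" "p \<in> U" "U \<subseteq> N"
      using \<N>(1)[OF N] unfolding neighbourhood_in_def by blast
    obtain c where "clopenin Z c" "p \<in> c" "c \<subseteq> U"
      by (rule clopen_basedE[OF clopen_based_Z U(1,2)])
    then show ?thesis using U by blast
  qed
  then obtain c where c: "\<And>N. N \<in> \<N> \<Longrightarrow> clopenin Z (c N) \<and> p \<in> c N \<and> c N \<subseteq> N"
    by metis
  show ?thesis
  proof (rule that[of "(\<lambda>N. D - c N) ` \<N>"])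
    show "clopenin Z S \<and> S \<subseteq> D \<inter> E" if "S \<in> (\<lambda>N. D - c N) ` \<N>" for S
      using that c D clopenin_diff[OF D(1)] by blast
    show "|(\<lambda>N. D - c N) ` \<N>| <o \<kappa>"
      by (intro card_of_image_ordLess \<N>)
    show "\<not> \<Union>((\<lambda>N. D - c N) ` \<N>) \<subseteq> C" if C: "clopenin Z C" "C \<subseteq> E" for C
    proof
      assume sub: "\<Union>((\<lambda>N. D - c N) ` \<N>) \<subseteq> C"
      have "openin Z (D - C)" using D C by (auto simp: clopenin_def)
      moreover have "p \<in> D - C" using D C p by blast
      moreover have "D - C \<subseteq> N" if "N \<in> \<N>" for N
        using sub c[OF that] that by blast
      ultimately show False using none[of "D - C"] by blast
    qed
  qed
qed

text \<open>Two such points would give unbounded families inside disjoint clopen sets, whereas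
  \<open>one_side_bounded\<close> bounds one of any two disjoint small unions.\<close>

lemma at_most_one_not_P_point:
  assumes p: "p \<in> topspace Z - E" "\<not> P_point \<kappa> Z p" and q: "q \<in> topspace Z - E" "\<not> P_point \<kappa> Z q"
  shows "p = q"
proof (rule ccontr)
  assume "p \<noteq> q"
  obtain D where D: "clopenin Z D" "p \<in> D" "D \<subseteq> insert p E"
    using clopen_isolating_remainder_point p by blast
  obtain D' where D': "clopenin Z D'" "q \<in> D'" "D' \<subseteq> insert q E"
    using clopen_isolating_remainder_point q by blast
  \<comment> \<open>Subtracting \<open>D\<close> makes the two neighbourhoods disjoint;
    \<open>q\<close> survives because \<open>p\<close> is the only remainder point that
    \<open>D\<close> contains.\<close>
  have D'D: "clopenin Z (D' - D)" "q \<in> D' - D" "D' - D \<subseteq> insert q E"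
    using D D' \<open>p \<noteq> q\<close> q clopenin_diff by blast+
  obtain \<S> where \<S>: "\<And>S. S \<in> \<S> \<Longrightarrow> clopenin Z S \<and> S \<subseteq> D \<inter> E" "|\<S>| <o \<kappa>"
      "\<And>C. clopenin Z C \<Longrightarrow> C \<subseteq> E \<Longrightarrow> \<not> \<Union>\<S> \<subseteq> C"
    using not_P_point_unbounded_family[OF p D] by metis
  obtain \<T> where \<T>: "\<And>S. S \<in> \<T> \<Longrightarrow> clopenin Z S \<and> S \<subseteq> (D' - D) \<inter> E" "|\<T>| <o \<kappa>"
      "\<And>C. clopenin Z C \<Longrightarrow> C \<subseteq> E \<Longrightarrow> \<not> \<Union>\<T> \<subseteq> C"
    using not_P_point_unbounded_family[OF q D'D] by metis
  have "\<exists>C. clopenin Z C \<and> C \<subseteq> E \<and> (\<Union>\<S> \<subseteq> C \<and> C \<inter> \<Union>\<T> = {} \<or> \<Union>\<T> \<subseteq> C \<and> C \<inter> \<Union>\<S> = {})"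
    by (rule one_side_bounded) (use \<S>(1,2) \<T>(1,2) in blast)+
  then obtain C where C: "clopenin Z C" "C \<subseteq> E"
    and C': "\<Union>\<S> \<subseteq> C \<and> C \<inter> \<Union>\<T> = {} \<or> \<Union>\<T> \<subseteq> C \<and> C \<inter> \<Union>\<S> = {}"
    by (elim exE conjE)
  from C' show False
    using \<S>(3)[OF C] \<T>(3)[OF C] by (elim disjE conjE) (rule notE; assumption)+
qed

end

theorem theorem4p3:
  fixes \<kappa> :: "'k rel" and X :: "'a topology" and x :: 'a
    and Z :: "'b topology" and e :: "'a \<Rightarrow> 'b"
  assumes "Card_order \<kappa>" and "cinfinite \<kappa>" and "\<kappa> =o power_less \<kappa>"
    and "is_S \<kappa> X" and "x \<in> topspace X"
    and "finite_compactification (subtopology X (topspace X - {x})) Z e"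
  shows "Z homeomorphic_space X \<and>
    (\<exists>\<^sub>\<le>\<^sub>1 p. p \<in> remainder (subtopology X (topspace X - {x})) Z e \<and> \<not> P_point \<kappa> Z p)"
proof -
  have \<kappa>: "Cinfinite \<kappa>" using assms by blast
  have "saturated_Stone_space \<kappa> X"
    using Parovicenko_imp_saturated[OF \<kappa>] assms unfolding is_S_def by blast
  then interpret punctured_compactification \<kappa> X x Z e
    using assms by (intro punctured_compactification.intro punctured_compactification_axioms.intro)
  have "Z homeomorphic_space X"
    by (rule saturated_Stone_space_unique[OF saturated_Z \<open>saturated_Stone_space \<kappa> X\<close>])
  moreover have "\<exists>\<^sub>\<le>\<^sub>1 p. p \<in> remainder Y Z e \<and> \<not> P_point \<kappa> Z p"
    unfolding remainder_eq by (intro Uniq_I) (elim conjE, rule at_most_one_not_P_point)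
  ultimately show ?thesis by blast
qed

end
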